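(* Let $q\in\mathbb{C}^{*}$ be not a root of unity and let $L/k=(\mathbb{C}(t,\log t),\sigma,\sigma^{-1},\theta^* )/\mathbb{C}$ be the $q$-skew iterative $\sigma$-differential field extension described in the context. Then there is an inclusion $$\mathcal{NCF}_{L/k}\hookrightarrow\widehat{QG}_{III\,q}$$ of functors on the category $(NCAlg/L^\natural)$ with values in the category of sets. Assume moreover that the functorial injection $\mathcal{NCF}_{L/k}(A)\to\widehat{QG}_{3\,q}(A)$ described in the context is bijective for every $A\in(NCAlg/L^\natural)$. Then the inclusion $\mathcal{NCF}_{L/k}\hookrightarrow\widehat{QG}_{III\,q}$ is a bijection, so that $\mathcal{NCF}_{L/k}\simeq\widehat{QG}_{III\,q}$, and the quantum formal group $\widehat{QG}_{III\,q}$ operates on the functor $\mathcal{NCF}_{L/k}$ through the initial conditions: if $u\in\widehat{QG}_{III\,q}(A)$ and $\varphi\in\mathcal{NCF}_{L/k}(A)$ corresponds to $v\in\widehat{QG}_{III\,q}(A)$, and the product $u*v$ is defined (the mutual commutativity condition of the context holds), then $u\cdot\varphi$ is the deformation corresponding to $u*v$. (In this sense the quantum formal Galois group of $L/k$ is $\widehat{QG}_{III\,q}$.)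
   Context: Notation. $[n]_q=1+q+\dots+q^{n-1}$, $[n]_q!=\prod_{i=1}^n[i]_q$, $[0]_q!=1$, $\binom{m}{n}_q=\frac{[m]_q!}{[n]_q![m-n]_q!}$. A value of $\log q$ is fixed. All algebras are associative and unital. The field. $y=\log t$; $t$ and $y$ are algebraically independent over $\mathbb{C}$. $\sigma$ is the $\mathbb{C}$-automorphism of $\mathbb{C}(t,y)$ with $\sigma(t)=qt$, $\sigma(y)=y+\log q$; $\theta^{(0)}=\mathrm{Id}$, $\theta^{(1)}(a)=\frac{\sigma(a)-a}{(q-1)t}$, $\theta^{(n)}=\frac1{[n]_q!}(\theta^{(1)})^n$. $L^\natural$ is the abstract field; $L^\sharp$ is $L^\natural$ with the derivations $\partial/\partial t,\partial/\partial y$. Twisted power series. For a $\mathbb{C}$-algebra $B$, $F(\mathbb{Z},B)$ is the ring of functions $\mathbb{Z}\to B$ with shift $(\Sigma f)(n)=f(n+1)$. $F(\mathbb{Z},B)[[X]]$ is the set of formal series $\sum_{i\ge0}X^ia_i$, $a_i\in F(\mathbb{Z},B)$, with multiplication determined by $aX=X\Sigma(a)$, and operators $\hat\Sigma(\sum X^ia_i)=\sum X^iq^i\Sigma(a_i)$, $\hat\Theta^{(l)}(\sum X^ia_i)=\sum X^i\binom{i+l}{l}_qa_{i+l}$. Derivations of $B$ act on coefficients. Galois hull. The universal Hopf morphism is $\iota_0:L\to F(\mathbb{Z},L^\natural)[[X]]$, $a\mapsto\sum_iX^iu[\theta^{(i)}(a)]$, $u[b](n)=\sigma^n(b)$. Elements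 of $L^\sharp$ are identified with constant functions of degree $0$ in $X$. $\mathcal{L}$ is the smallest subalgebra of $F(\mathbb{Z},L^\sharp)[[X]]$ containing $\iota_0(L)$ and $L^\sharp$ and invariant under $\hat\Sigma$, all $\hat\Theta^{(l)}$, $\partial/\partial t$, $\partial/\partial y$; $\mathcal{K}=L^\sharp$. Put $Q(n)=q^n$ and $Z(n)=n$ in $F(\mathbb{Z},\mathbb{C})$; then $\iota_0(t)=tQ+X$ and $\iota_0(y)=y+(\log q)Z+\frac{\log q}{q-1}\sum_{n\ge1}X^n(-1)^{n+1}\frac{1}{[n]_qq^{n(n-1)/2}}(tQ)^{-n}$. Deformations. $(NCAlg/L^\natural)$ is the category of not necessarily commutative $L^\natural$-algebras $A$ with $L^\natural$ mapping to the center. The Taylor morphism $L^\sharp\to L^\natural[[W_1,W_2]]$, $a\mapsto\sum\frac{1}{n!m!}\frac{\partial^{n+m}a}{\partial t^n\partial y^m}W_1^nW_2^m$ and $L^\natural\to A$ induce the canonical morphism $\iota:\mathcal{L}\to F(\mathbb{Z},A[[W_1,W_2]])[[X]]$. $\mathcal{NCF}_{L/k}(A)$ is the set of algebra morphisms $\varphi:\mathcal{L}\to F(\mathbb{Z},A[[W_1,W_2]])[[X]]$ compatible with $\hat\Sigma$, all $\hat\Theta^{(l)}$ and the derivations ($\partial/\partial t,\partial/\partial y$ on $\mathcal{L}$ corresponding to $\partial/\partial W_1,\partial/\partial W_2$), equal to $\iota$ on $\mathcal{K}$, and congruent to $\iota$ modulo nilpotent elements (all coefficients in $A$ of $\varphi(x)-\iota(x)$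 are nilpotent for every $x\in\mathcal{L}$). Quantum formal groups. $\widehat{QG}_{3\,q}(A)$ is the set of pairs $\left(\begin{bmatrix}e&f\\0&1\end{bmatrix},b(W_1)\right)$ with $e,f\in A$, $ef=qfe$, $b(W_1)\in A[[W_1]]$, $[e(t+W_1)+f,\,b(W_1)]=0$, and $e-1$, $f$ and all coefficients of $b(W_1)$ nilpotent. The injection $\mathcal{NCF}_{L/k}(A)\to\widehat{QG}_{3\,q}(A)$ sends $\varphi$ to the pair determined by $\varphi(\iota_0(t))=(e(t+W_1)+f)Q+X$ and $\varphi(\iota_0(y))=y+W_2+b(W_1)+(\log q)Z+\frac{\log q}{q-1}\sum_{n\ge1}X^n(-1)^{n+1}\frac{1}{[n]_qq^{n(n-1)/2}}(e(t+W_1)+f)^{-n}Q^{-n}$. $\widehat{QG}_{III\,q}(A)$ is the set of pairs $\bigl((e-1)t+f+eW_1,\ W_2+b(W_1)\bigr)\in A[[W_1,W_2]]^2$ with $e-1$, $f$ and all coefficients of $b(W_1)\in A[[W_1]]$ nilpotent, $ef=qfe$, and $[(e-1)t+f+eW_1,\ W_2+b(W_1)]=0$. The inclusion of the theorem sends $\varphi$ to the pair with the same $(e,f,b)$; the pair is regarded as the coordinate transformation of the initial conditions $(W_1,W_2)\mapsto((e-1)t+f+eW_1,W_2+b(W_1))$. For elements given by $(e,f,b)$ and $(g,h,c)$ such that $\{e,f\}\cup\{\text{coefficients of }b\}$ and $\{g,h\}\cup\{\text{coefficients of }c\}$ are mutually commutative (every element of one commutes with every element of the other), the product is the composite $\bigl((eg-1)t+eh+f+egW_1,\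 W_2+b((g-1)t+h+gW_1)+c(W_1)\bigr)$. *)

theory Defs
  imports "HOL-Computational_Algebra.Computational_Algebra" "HOL-Library.FuncSet"
begin

unbundle fps_syntax

section \<open>\<open>q\<close>-numbers\<close>

definition qint :: "complex \<Rightarrow> nat \<Rightarrow> complex" where
  "qint q n = (\<Sum>i<n. q ^ i)"

definition qfact :: "complex \<Rightarrow> nat \<Rightarrow> complex" where
  "qfact q n = (\<Prod>i=1..n. qint q i)"

definition qbinom :: "complex \<Rightarrow> nat \<Rightarrow> nat \<Rightarrow> complex" where
  "qbinom q m n = qfact q m / (qfact q n * qfact q (m - n))"


section \<open>The field \<open>\<complex>(t, y)\<close> with \<open>y = log t\<close>\<close>

text \<open>
  \<open>\<complex>(t, y)\<close> is the fraction field of \<open>\<complex>[t][y]\<close>: the inner polynomial variable is \<open>t\<close>, the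
  outer one is \<open>y\<close>. The same type serves for the abstract field and for the field
  equipped with \<open>\<partial>/\<partial>t\<close> and \<open>\<partial>/\<partial>y\<close>.
\<close>

type_synonym ratfun = "complex poly poly fract"

definition cst :: "complex \<Rightarrow> ratfun" where
  "cst c = Fraction_Field.Fract [:[:c:]:] 1"

definition tvar :: ratfun where
  "tvar = Fraction_Field.Fract [:[:0, 1:]:] 1"

definition yvar :: ratfun where
  "yvar = Fraction_Field.Fract [:0, 1:] 1"

text \<open>
  The extension of an injective ring endomorphism, respectively of a derivation, of a domain
  to its fraction field.
\<close>

definition fract_extend_hom :: "('r::idom \<Rightarrow> 'r) \<Rightarrow> 'r fract \<Rightarrow> 'r fract" where
  "fract_extend_hom h x =
     (THE z. \<forall>a b. b \<noteq> 0 \<longrightarrow> x = Fraction_Field.Fract a b \<longrightarrow> z = Fraction_Field.Fract (h a) (h b))"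

definition fract_extend_deriv :: "('r::idom \<Rightarrow> 'r) \<Rightarrow> 'r fract \<Rightarrow> 'r fract" where
  "fract_extend_deriv d x =
     (THE z. \<forall>a b. b \<noteq> 0 \<longrightarrow> x = Fraction_Field.Fract a b \<longrightarrow>
        z = Fraction_Field.Fract (d a * b - a * d b) (b * b))"

definition sigma_poly :: "complex \<Rightarrow> complex \<Rightarrow> complex poly poly \<Rightarrow> complex poly poly" where
  "sigma_poly q lq p = pcompose (map_poly (\<lambda>c. pcompose c [:0, q:]) p) [:[:lq:], 1:]"

text \<open>Throughout, \<open>lq\<close> is the fixed value of \<open>log q\<close>.\<close>

definition sigma :: "complex \<Rightarrow> complex \<Rightarrow> ratfun \<Rightarrow> ratfun" where
  "sigma q lq = fract_extend_hom (sigma_poly q lq)"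

definition deriv_t :: "ratfun \<Rightarrow> ratfun" where
  "deriv_t = fract_extend_deriv (map_poly pderiv)"

definition deriv_y :: "ratfun \<Rightarrow> ratfun" where
  "deriv_y = fract_extend_deriv pderiv"

lemma fract_extend_hom_Fract:
  assumes "\<And>a b. h (a * b) = h a * h b" "\<And>a. h a = 0 \<Longrightarrow> a = 0" and b: "b \<noteq> 0"
  shows "fract_extend_hom h (Fraction_Field.Fract a b) = Fraction_Field.Fract (h a) (h b)"
proof -
  have "Fraction_Field.Fract (h a) (h b) = Fraction_Field.Fract (h a') (h b')"
    if "b' \<noteq> 0" "Fraction_Field.Fract a b = Fraction_Field.Fract a' b'" for a' b'
  proof -
    have "a * b' = a' * b" using that b by (simp add: eq_fract)
    then have "h a * h b' = h a' * h b" using assms(1) by metis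
    moreover have "h b \<noteq> 0" "h b' \<noteq> 0" using assms(2) b that by blast+
    ultimately show ?thesis by (simp add: eq_fract)
  qed
  then show ?thesis
    unfolding fract_extend_hom_def using b by (intro the_equality) blast+
qed

lemma fract_extend_deriv_Fract:
  assumes d: "\<And>a b. d (a * b) = d a * b + a * d b" and b: "b \<noteq> 0"
  shows "fract_extend_deriv d (Fraction_Field.Fract a b) =
    Fraction_Field.Fract (d a * b - a * d b) (b * b)"
proof -
  have "Fraction_Field.Fract (d a * b - a * d b) (b * b) =
      Fraction_Field.Fract (d a' * b' - a' * d b') (b' * b')"
    if "b' \<noteq> 0" "Fraction_Field.Fract a b = Fraction_Field.Fract a' b'" for a' b'
  proof -
    have e: "a * b' = a' * b" using that b by (simp add: eq_fract)
    then have e': "d a * b' + a * d b' = d a' * b + a' * d b" using d by metis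
    have "(d a * b - a * d b) * (b' * b') = (d a * b' + a * d b') * b * b' - (a * b') * d (b * b')"
      by (simp add: d algebra_simps)
    also have "\<dots> = (d a' * b + a' * d b) * b * b' - (a' * b) * d (b * b')"
      by (simp only: e e')
    also have "\<dots> = (d a' * b' - a' * d b') * (b * b)"
      by (simp add: d algebra_simps)
    finally show ?thesis using that b by (simp add: eq_fract)
  qed
  then show ?thesis
    unfolding fract_extend_deriv_def using b by (intro the_equality) blast+
qed

lemma sigma_poly_mult: "sigma_poly q lq (a * b) = sigma_poly q lq a * sigma_poly q lq b"
proof -
  have "map_poly (\<lambda>c. pcompose c [:0, q:]) (a * b) =
      map_poly (\<lambda>c. pcompose c [:0, q:]) a * map_poly (\<lambda>c. pcompose c [:0, q:]) b"
    by (rule poly_eqI) (simp add: coeff_map_poly coeff_mult pcompose_sum pcompose_mult)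
  then show ?thesis by (simp add: sigma_poly_def pcompose_mult)
qed

lemma sigma_poly_eq_0:
  assumes "q \<noteq> 0" "sigma_poly q lq a = 0"
  shows "a = 0"
proof -
  have 1: "map_poly (\<lambda>c. pcompose c [:0, q:]) a = 0"
    using assms(2) unfolding sigma_poly_def by (rule pcompose_eq_0) simp
  show ?thesis
  proof (rule poly_eqI)
    fix n
    have "pcompose (coeff a n) [:0, q:] = 0"
      using arg_cong[OF 1, of "\<lambda>p. coeff p n"] by (simp add: coeff_map_poly)
    then have "coeff a n = 0" by (rule pcompose_eq_0) (simp add: assms(1))
    then show "coeff a n = coeff 0 n" by simp
  qed
qed

lemma sigma_Fract:
  "q \<noteq> 0 \<Longrightarrow> b \<noteq> 0 \<Longrightarrow> sigma q lq (Fraction_Field.Fract a b) =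
     Fraction_Field.Fract (sigma_poly q lq a) (sigma_poly q lq b)"
  unfolding sigma_def
  by (rule fract_extend_hom_Fract) (auto intro: sigma_poly_mult dest: sigma_poly_eq_0)

lemma sigma_generators:
  assumes "q \<noteq> 0"
  shows "sigma q lq (cst c) = cst c"
    and "sigma q lq tvar = cst q * tvar"
    and "sigma q lq yvar = yvar + cst lq"
  using assms
  by (simp_all add: cst_def tvar_def yvar_def sigma_Fract sigma_poly_def map_poly_pCons
      pcompose_pCons one_pCons)

lemma deriv_t_Fract:
  "b \<noteq> 0 \<Longrightarrow> deriv_t (Fraction_Field.Fract a b) =
     Fraction_Field.Fract (map_poly pderiv a * b - a * map_poly pderiv b) (b * b)"
  unfolding deriv_t_def
proof (rule fract_extend_deriv_Fract)
  fix a b :: "complex poly poly"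
  have pderiv_sum: "pderiv (\<Sum>i\<in>I. f i) = (\<Sum>i\<in>I. pderiv (f i))"
    for f :: "nat \<Rightarrow> complex poly" and I
    by (induction I rule: infinite_finite_induct) (simp_all add: pderiv_add)
  show "map_poly pderiv (a * b) = map_poly pderiv a * b + a * map_poly pderiv b"
  proof (rule poly_eqI)
    fix n
    have "coeff (map_poly pderiv (a * b)) n =
        (\<Sum>i\<le>n. pderiv (coeff a i) * coeff b (n - i) + coeff a i * pderiv (coeff b (n - i)))"
      unfolding coeff_map_poly[of pderiv, OF pderiv_0] coeff_mult pderiv_sum pderiv_mult
      by (simp add: algebra_simps)
    then show "coeff (map_poly pderiv (a * b)) n =
        coeff (map_poly pderiv a * b + a * map_poly pderiv b) n"
      by (simp add: coeff_map_poly coeff_mult sum.distrib)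
  qed
qed

lemma deriv_y_Fract:
  "b \<noteq> 0 \<Longrightarrow> deriv_y (Fraction_Field.Fract a b) =
     Fraction_Field.Fract (pderiv a * b - a * pderiv b) (b * b)"
  unfolding deriv_y_def
  by (rule fract_extend_deriv_Fract) (simp_all add: pderiv_mult algebra_simps)

lemma deriv_generators:
  "deriv_t (cst c) = 0" "deriv_t tvar = 1" "deriv_t yvar = 0"
  "deriv_y (cst c) = 0" "deriv_y tvar = 0" "deriv_y yvar = 1"
  by (simp_all add: cst_def tvar_def yvar_def deriv_t_Fract deriv_y_Fract map_poly_pCons
      pderiv_pCons Zero_fract_def One_fract_def one_pCons)

definition theta1 :: "complex \<Rightarrow> complex \<Rightarrow> ratfun \<Rightarrow> ratfun" where
  "theta1 q lq a = (sigma q lq a - a) / (cst (q - 1) * tvar)"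

definition theta :: "complex \<Rightarrow> complex \<Rightarrow> nat \<Rightarrow> ratfun \<Rightarrow> ratfun" where
  "theta q lq n a = cst (1 / qfact q n) * (theta1 q lq ^^ n) a"

definition sigma_zpow :: "complex \<Rightarrow> complex \<Rightarrow> int \<Rightarrow> ratfun \<Rightarrow> ratfun" where
  "sigma_zpow q lq n =
     (if 0 \<le> n then sigma q lq ^^ nat n else inv (sigma q lq) ^^ nat (- n))"


section \<open>Power series with noncommutative coefficients\<close>

text \<open>
  Coefficient rings have sort \<open>{ring, monoid_mult}\<close> rather than \<open>ring_1\<close>, since the latter
  excludes the zero ring.
\<close>

instance fps :: ("{semiring_0, monoid_mult}") monoid_mult
  by standard (simp_all add: fps_one_mult mult.assoc)

text \<open>
  \<open>A[[W\<^sub>1, W\<^sub>2]]\<close> is \<open>A[[W\<^sub>1]][[W\<^sub>2]]\<close>, so \<open>F $ m $ n\<close> is the coefficient of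
  \<open>W\<^sub>1\<^sup>n W\<^sub>2\<^sup>m\<close>.
\<close>

type_synonym 'a fps2 = "'a fps fps"

definition const2 :: "'a::zero \<Rightarrow> 'a fps2" where
  "const2 a = fps_const (fps_const a)"

definition W1 :: "'a::{zero, one} fps2" where
  "W1 = fps_const fps_X"

definition W2 :: "'a::{zero, one} fps2" where
  "W2 = fps_X"

text \<open>
  The multiples \<open>(n + 1) c\<close> are written as sums because there are no numerals in sort
  \<open>{ring, monoid_mult}\<close>.
\<close>

definition deriv_W1 :: "'a::comm_monoid_add fps2 \<Rightarrow> 'a fps2" where
  "deriv_W1 F = Abs_fps (\<lambda>m. Abs_fps (\<lambda>n. \<Sum>i<Suc n. F $ m $ Suc n))"

definition deriv_W2 :: "'a::comm_monoid_add fps2 \<Rightarrow> 'a fps2" where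
  "deriv_W2 F = Abs_fps (\<lambda>m. Abs_fps (\<lambda>n. \<Sum>i<Suc m. F $ Suc m $ n))"

definition map_fps :: "('a \<Rightarrow> 'b) \<Rightarrow> 'a fps \<Rightarrow> 'b fps" where
  "map_fps h F = Abs_fps (\<lambda>n. h (F $ n))"

definition map_fps2 :: "('a \<Rightarrow> 'b) \<Rightarrow> 'a fps2 \<Rightarrow> 'b fps2" where
  "map_fps2 h = map_fps (map_fps h)"

text \<open>
  The substitution \<open>b(s) = \<Sum>\<^sub>n b\<^sub>n s\<^sup>n\<close>, for \<open>s\<close> in \<open>A[[W\<^sub>1]]\<close> whose constant term need not
  vanish. Coefficientwise the sum runs over the indices of the nonzero terms; for the
  nilpotent constant terms to which the substitution is applied these are finitely many.
\<close>

definition fps_subst :: "'a::{ring, monoid_mult} fps \<Rightarrow> 'a fps \<Rightarrow> 'a fps" where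
  "fps_subst b s = Abs_fps (\<lambda>m. \<Sum>n | b $ n * (s ^ n) $ m \<noteq> 0. b $ n * (s ^ n) $ m)"

definition nilpotent :: "'a::{ring, monoid_mult} \<Rightarrow> bool" where
  "nilpotent x \<longleftrightarrow> (\<exists>n. x ^ n = 0)"

definition ring_inverse :: "'a::{ring, monoid_mult} \<Rightarrow> 'a" where
  "ring_inverse x = (THE z. x * z = 1 \<and> z * x = 1)"


section \<open>Twisted power series \<open>F(\<int>, B)[[X]]\<close>\<close>

text \<open>\<open>tps_nth F i n\<close> is the value \<open>a\<^sub>i(n)\<close>, where \<open>F = \<Sum>\<^sub>i X\<^sup>i a\<^sub>i\<close>.\<close>

typedef 'b tps = "UNIV :: (nat \<Rightarrow> int \<Rightarrow> 'b) set"
  morphisms tps_nth Abs_tps ..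

lemma tps_nth_Abs_tps [simp]: "tps_nth (Abs_tps f) = f"
  by (simp add: Abs_tps_inverse)

lemma tps_eqI: "(\<And>i n. tps_nth F i n = tps_nth G i n) \<Longrightarrow> F = G"
  by (metis ext tps_nth_inject)

text \<open>
  From \<open>a X = X \<Sigma>(a)\<close> one gets \<open>(X\<^sup>i a) (X\<^sup>j b) = X\<^sup>i\<^sup>+\<^sup>j \<Sigma>\<^sup>j(a) b\<close>.
\<close>

instantiation tps :: (ring) ring
begin

definition zero_tps_def: "0 = Abs_tps (\<lambda>i n. 0)"
definition plus_tps_def: "F + G = Abs_tps (\<lambda>i n. tps_nth F i n + tps_nth G i n)"
definition minus_tps_def: "F - G = Abs_tps (\<lambda>i n. tps_nth F i n - tps_nth G i n)"
definition uminus_tps_def: "- F = Abs_tps (\<lambda>i n. - tps_nth F i n)"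
definition times_tps_def:
  "F * G = Abs_tps (\<lambda>k n. \<Sum>i=0..k. tps_nth F i (n + int (k - i)) * tps_nth G (k - i) n)"

instance
proof
  fix F G H :: "'a tps"
  show "F * G * H = F * (G * H)"
  proof (rule tps_eqI)
    fix k n
    let ?f = "\<lambda>i j l. tps_nth F i (n + int l + int j) * tps_nth G j (n + int l) * tps_nth H l n"
    have "tps_nth (F * G * H) k n = (\<Sum>j=0..k. \<Sum>i=0..j. ?f i (j - i) (k - j))"
      by (simp add: times_tps_def sum_distrib_right)
    also have "\<dots> = (\<Sum>j=0..k. \<Sum>i=0..k - j. ?f j i (k - j - i))"
      by (rule fps_mult_assoc_lemma)
    also have "\<dots> = tps_nth (F * (G * H)) k n"
      by (simp add: times_tps_def sum_distrib_left mult.assoc diff_diff_eq of_nat_diff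
          cong: sum.cong_simp)
    finally show "tps_nth (F * G * H) k n = tps_nth (F * (G * H)) k n" .
  qed
qed (auto intro!: tps_eqI simp: zero_tps_def plus_tps_def minus_tps_def uminus_tps_def
    times_tps_def algebra_simps sum.distrib)

end

instantiation tps :: ("{ring, monoid_mult}") monoid_mult
begin

definition one_tps_def: "1 = Abs_tps (\<lambda>i n. if i = 0 then 1 else 0)"

instance
proof
  fix F :: "'a tps"
  show "1 * F = F"
    by (rule tps_eqI) (simp add: one_tps_def times_tps_def if_distrib[where f = "\<lambda>x. x * _"] cong: if_cong)
  have "tps_nth (F * 1) k n = tps_nth F k n" for k n
  proof -
    have "tps_nth (F * 1) k n = (\<Sum>i=0..k. if i = k then tps_nth F k n else 0)"
      unfolding one_tps_def times_tps_def tps_nth_Abs_tps by (rule sum.cong) auto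
    then show ?thesis by simp
  qed
  then show "F * 1 = F" by (rule tps_eqI)
qed

end

definition tps_fun :: "(int \<Rightarrow> 'b::zero) \<Rightarrow> 'b tps" where
  "tps_fun a = Abs_tps (\<lambda>i n. if i = 0 then a n else 0)"

definition tps_const :: "'b::zero \<Rightarrow> 'b tps" where
  "tps_const c = tps_fun (\<lambda>_. c)"

definition tps_X :: "'b::{zero, one} tps" where
  "tps_X = Abs_tps (\<lambda>i n. if i = 1 then 1 else 0)"

definition map_tps :: "('b \<Rightarrow> 'c) \<Rightarrow> 'b tps \<Rightarrow> 'c tps" where
  "map_tps h F = Abs_tps (\<lambda>i n. h (tps_nth F i n))"

text \<open>In the two operators \<open>s\<close> is the structure map \<open>\<complex> \<rightarrow> B\<close> of the coefficient algebra.\<close>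

definition hat_Sigma :: "(complex \<Rightarrow> 'b::times) \<Rightarrow> complex \<Rightarrow> 'b tps \<Rightarrow> 'b tps" where
  "hat_Sigma s q F = Abs_tps (\<lambda>i n. s (q ^ i) * tps_nth F i (n + 1))"

definition hat_Theta :: "(complex \<Rightarrow> 'b::times) \<Rightarrow> complex \<Rightarrow> nat \<Rightarrow> 'b tps \<Rightarrow> 'b tps" where
  "hat_Theta s q l F = Abs_tps (\<lambda>i n. s (qbinom q (i + l) l) * tps_nth F (i + l) n)"


section \<open>The Galois hull\<close>

definition iota0 :: "complex \<Rightarrow> complex \<Rightarrow> ratfun \<Rightarrow> ratfun tps" where
  "iota0 q lq a = Abs_tps (\<lambda>i n. sigma_zpow q lq n (theta q lq i a))"

text \<open>Closure under negation and under \<open>\<complex>\<close>-scalars is implied by containing the constants.\<close>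

inductive_set galois_hull :: "complex \<Rightarrow> complex \<Rightarrow> ratfun tps set" for q lq where
  iota0: "iota0 q lq a \<in> galois_hull q lq"
| const: "tps_const a \<in> galois_hull q lq"
| add: "F \<in> galois_hull q lq \<Longrightarrow> G \<in> galois_hull q lq \<Longrightarrow> F + G \<in> galois_hull q lq"
| mult: "F \<in> galois_hull q lq \<Longrightarrow> G \<in> galois_hull q lq \<Longrightarrow> F * G \<in> galois_hull q lq"
| hat_Sigma: "F \<in> galois_hull q lq \<Longrightarrow> hat_Sigma cst q F \<in> galois_hull q lq"
| hat_Theta: "F \<in> galois_hull q lq \<Longrightarrow> hat_Theta cst q l F \<in> galois_hull q lq"
| deriv_t: "F \<in> galois_hull q lq \<Longrightarrow> map_tps deriv_t F \<in> galois_hull q lq"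
| deriv_y: "F \<in> galois_hull q lq \<Longrightarrow> map_tps deriv_y F \<in> galois_hull q lq"


section \<open>The category \<open>(NCAlg/L\<^sup>\<natural>)\<close> and the functor of deformations\<close>

text \<open>An object is a ring type together with its structure map from \<open>\<complex>(t, y)\<close>.\<close>

definition nc_algebra :: "(ratfun \<Rightarrow> 'a::{ring, monoid_mult}) \<Rightarrow> bool" where
  "nc_algebra \<eta> \<longleftrightarrow>
     \<eta> 1 = 1 \<and> (\<forall>x y. \<eta> (x + y) = \<eta> x + \<eta> y) \<and> (\<forall>x y. \<eta> (x * y) = \<eta> x * \<eta> y) \<and>
     (\<forall>x a. \<eta> x * a = a * \<eta> x)"

definition nc_algebra_hom ::
  "(ratfun \<Rightarrow> 'a::{ring, monoid_mult}) \<Rightarrow> (ratfun \<Rightarrow> 'b::{ring, monoid_mult}) \<Rightarrow> ('a \<Rightarrow> 'b) \<Rightarrow> bool" where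
  "nc_algebra_hom \<eta> \<eta>' h \<longleftrightarrow>
     (\<forall>x y. h (x + y) = h x + h y) \<and> (\<forall>x y. h (x * y) = h x * h y) \<and> (\<forall>x. h (\<eta> x) = \<eta>' x)"

text \<open>The structure map \<open>\<complex> \<rightarrow> A[[W\<^sub>1, W\<^sub>2]]\<close>.\<close>

definition scalar2 :: "(ratfun \<Rightarrow> 'a::zero) \<Rightarrow> complex \<Rightarrow> 'a fps2" where
  "scalar2 \<eta> c = const2 (\<eta> (cst c))"

definition taylor :: "(ratfun \<Rightarrow> 'a) \<Rightarrow> ratfun \<Rightarrow> 'a fps2" where
  "taylor \<eta> a = Abs_fps (\<lambda>m. Abs_fps (\<lambda>n.
     \<eta> (cst (1 / (fact n * fact m)) * (deriv_t ^^ n) ((deriv_y ^^ m) a))))"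

definition iota :: "(ratfun \<Rightarrow> 'a) \<Rightarrow> ratfun tps \<Rightarrow> 'a fps2 tps" where
  "iota \<eta> = map_tps (taylor \<eta>)"

text \<open>
  Deformations are functions on the Galois hull; outside of it they take the value
  \<open>undefined\<close>, so that equality of deformations is equality of functions. They are
  \<open>\<complex>\<close>-linear because they agree with \<open>iota\<close> on constants.
\<close>

definition NCF ::
  "complex \<Rightarrow> complex \<Rightarrow> (ratfun \<Rightarrow> 'a::{ring, monoid_mult}) \<Rightarrow> (ratfun tps \<Rightarrow> 'a fps2 tps) set" where
  "NCF q lq \<eta> = {\<phi> \<in> extensional (galois_hull q lq).
     \<phi> 1 = 1 \<and>
     (\<forall>F \<in> galois_hull q lq. \<forall>G \<in> galois_hull q lq.
        \<phi> (F + G) = \<phi> F + \<phi> G \<and> \<phi> (F * G) = \<phi> F * \<phi> G) \<and>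
     (\<forall>F \<in> galois_hull q lq.
        \<phi> (hat_Sigma cst q F) = hat_Sigma (scalar2 \<eta>) q (\<phi> F) \<and>
        (\<forall>l. \<phi> (hat_Theta cst q l F) = hat_Theta (scalar2 \<eta>) q l (\<phi> F)) \<and>
        \<phi> (map_tps deriv_t F) = map_tps deriv_W1 (\<phi> F) \<and>
        \<phi> (map_tps deriv_y F) = map_tps deriv_W2 (\<phi> F)) \<and>
     (\<forall>a. \<phi> (tps_const a) = iota \<eta> (tps_const a)) \<and>
     (\<forall>F \<in> galois_hull q lq. \<forall>i n m l. nilpotent (tps_nth (\<phi> F - iota \<eta> F) i n $ m $ l))}"

definition NCF_map ::
  "complex \<Rightarrow> complex \<Rightarrow> ('a \<Rightarrow> 'b) \<Rightarrow> (ratfun tps \<Rightarrow> 'a fps2 tps) \<Rightarrow> ratfun tps \<Rightarrow> 'b fps2 tps" where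
  "NCF_map q lq h \<phi> = restrict (\<lambda>F. map_tps (map_fps2 h) (\<phi> F)) (galois_hull q lq)"


lemma map_tps_map_fps2_id: "map_tps (map_fps2 (\<lambda>x. x)) G = G"
  by (rule tps_eqI) (simp add: map_tps_def map_fps2_def map_fps_def fps_eq_iff)

lemma NCF_map_functorial:
  "\<phi> \<in> NCF q lq \<eta> \<Longrightarrow> NCF_map q lq (\<lambda>x. x) \<phi> = \<phi>"
  "NCF_map q lq h' (NCF_map q lq h \<phi>) = NCF_map q lq (\<lambda>x. h' (h x)) \<phi>"
proof -
  assume "\<phi> \<in> NCF q lq \<eta>"
  then have "\<phi> \<in> extensional (galois_hull q lq)"
    unfolding NCF_def by blast
  then show "NCF_map q lq (\<lambda>x. x) \<phi> = \<phi>"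
    by (simp add: NCF_map_def map_tps_map_fps2_id extensional_restrict)
next
  show "NCF_map q lq h' (NCF_map q lq h \<phi>) = NCF_map q lq (\<lambda>x. h' (h x)) \<phi>"
    by (rule ext) (simp add: NCF_map_def restrict_def map_tps_def map_fps2_def map_fps_def)
qed


section \<open>The quantum formal groups\<close>

text \<open>A matrix with rows \<open>(p, r)\<close> and \<open>(s, u)\<close> is the pair of its rows.\<close>

type_synonym 'a mat2 = "('a \<times> 'a) \<times> ('a \<times> 'a)"

definition QG3 :: "complex \<Rightarrow> (ratfun \<Rightarrow> 'a::{ring, monoid_mult}) \<Rightarrow> ('a mat2 \<times> 'a fps) set" where
  "QG3 q \<eta> = {(((e, f), (0, 1)), b) | e f b.
     e * f = \<eta> (cst q) * f * e \<and>
     (fps_const e * (fps_const (\<eta> tvar) + fps_X) + fps_const f) * b =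
       b * (fps_const e * (fps_const (\<eta> tvar) + fps_X) + fps_const f) \<and>
     nilpotent (e - 1) \<and> nilpotent f \<and> (\<forall>n. nilpotent (b $ n))}"

definition trans_pair ::
  "(ratfun \<Rightarrow> 'a::{ring, monoid_mult}) \<Rightarrow> 'a \<Rightarrow> 'a \<Rightarrow> 'a fps \<Rightarrow> 'a fps2 \<times> 'a fps2" where
  "trans_pair \<eta> e f b = (const2 ((e - 1) * \<eta> tvar + f) + const2 e * W1, W2 + fps_const b)"

definition QGIII :: "complex \<Rightarrow> (ratfun \<Rightarrow> 'a::{ring, monoid_mult}) \<Rightarrow> ('a fps2 \<times> 'a fps2) set" where
  "QGIII q \<eta> = {trans_pair \<eta> e f b | e f b.
     nilpotent (e - 1) \<and> nilpotent f \<and> (\<forall>n. nilpotent (b $ n)) \<and>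
     e * f = \<eta> (cst q) * f * e \<and>
     fst (trans_pair \<eta> e f b) * snd (trans_pair \<eta> e f b) =
       snd (trans_pair \<eta> e f b) * fst (trans_pair \<eta> e f b)}"

definition QGIII_map :: "('a \<Rightarrow> 'b) \<Rightarrow> 'a fps2 \<times> 'a fps2 \<Rightarrow> 'b fps2 \<times> 'b fps2" where
  "QGIII_map h = map_prod (map_fps2 h) (map_fps2 h)"

lemma QGIII_map_functorial:
  "QGIII_map (\<lambda>x. x) u = u"
  "QGIII_map h' (QGIII_map h u) = QGIII_map (\<lambda>x. h' (h x)) u"
  by (cases u; simp add: QGIII_map_def map_fps2_def map_fps_def fps_eq_iff)+

text \<open>The entries \<open>e\<close>, \<open>f\<close>, \<open>b\<close> recovered from the pair they define.\<close>

definition par_e :: "'a fps2 \<times> 'a fps2 \<Rightarrow> 'a" where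
  "par_e u = fst u $ 0 $ 1"

definition par_f :: "(ratfun \<Rightarrow> 'a::{ring, monoid_mult}) \<Rightarrow> 'a fps2 \<times> 'a fps2 \<Rightarrow> 'a" where
  "par_f \<eta> u = fst u $ 0 $ 0 - (par_e u - 1) * \<eta> tvar"

definition par_b :: "'a fps2 \<times> 'a fps2 \<Rightarrow> 'a fps" where
  "par_b u = snd u $ 0"

lemma par_trans_pair [simp]:
  "par_e (trans_pair \<eta> e f b) = e"
  "par_f \<eta> (trans_pair \<eta> e f b) = f"
  "par_b (trans_pair \<eta> e f b) = b"
proof -
  show *: "par_e (trans_pair \<eta> e f b) = e"
    by (simp add: par_e_def trans_pair_def const2_def W1_def fps_X_def fps_mult_nth)
  show "par_f \<eta> (trans_pair \<eta> e f b) = f"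
    unfolding par_f_def *
    by (simp add: trans_pair_def const2_def W1_def fps_X_def)
  show "par_b (trans_pair \<eta> e f b) = b"
    by (simp add: par_b_def trans_pair_def W2_def fps_X_def)
qed

definition params ::
  "(ratfun \<Rightarrow> 'a::{ring, monoid_mult}) \<Rightarrow> 'a fps2 \<times> 'a fps2 \<Rightarrow> 'a set" where
  "params \<eta> u = {par_e u, par_f \<eta> u} \<union> range (\<lambda>n. par_b u $ n)"

definition mutually_commute ::
  "(ratfun \<Rightarrow> 'a::{ring, monoid_mult}) \<Rightarrow> 'a fps2 \<times> 'a fps2 \<Rightarrow> 'a fps2 \<times> 'a fps2 \<Rightarrow> bool" where
  "mutually_commute \<eta> u v \<longleftrightarrow> (\<forall>x \<in> params \<eta> u. \<forall>y \<in> params \<eta> v. x * y = y * x)"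

definition QGIII_unit :: "(ratfun \<Rightarrow> 'a::{ring, monoid_mult}) \<Rightarrow> 'a fps2 \<times> 'a fps2" where
  "QGIII_unit \<eta> = (W1, W2)"

text \<open>
  The composite of two coordinate transformations: \<open>u\<close> after \<open>v\<close>, where \<open>u\<close> and \<open>v\<close> have
  entries \<open>(e, f, b)\<close> and \<open>(g, h, c)\<close>.
\<close>

definition QGIII_prod ::
  "(ratfun \<Rightarrow> 'a::{ring, monoid_mult}) \<Rightarrow> 'a fps2 \<times> 'a fps2 \<Rightarrow> 'a fps2 \<times> 'a fps2 \<Rightarrow> 'a fps2 \<times> 'a fps2" where
  "QGIII_prod \<eta> u v =
     (let e = par_e u; f = par_f \<eta> u; b = par_b u; g = par_e v; h = par_f \<eta> v; c = par_b v in
        (const2 ((e * g - 1) * \<eta> tvar + e * h + f) + const2 (e * g) * W1,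
         W2 + fps_const (fps_subst b (fps_const ((g - 1) * \<eta> tvar + h) + fps_const g * fps_X) + c)))"


section \<open>Deformations and their parameters\<close>

text \<open>\<open>e (t + W\<^sub>1) + f\<close>\<close>

definition lin_W1 :: "(ratfun \<Rightarrow> 'a::{ring, monoid_mult}) \<Rightarrow> 'a \<Rightarrow> 'a \<Rightarrow> 'a fps2" where
  "lin_W1 \<eta> e f = const2 e * (const2 (\<eta> tvar) + W1) + const2 f"

text \<open>The prescribed images of \<open>\<iota>\<^sub>0(t)\<close> and of \<open>\<iota>\<^sub>0(y)\<close>.\<close>

definition image_t ::
  "complex \<Rightarrow> (ratfun \<Rightarrow> 'a::{ring, monoid_mult}) \<Rightarrow> 'a \<Rightarrow> 'a \<Rightarrow> 'a fps2 tps" where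
  "image_t q \<eta> e f = tps_const (lin_W1 \<eta> e f) * tps_fun (\<lambda>n. scalar2 \<eta> (q powi n)) + tps_X"

definition image_y ::
  "complex \<Rightarrow> complex \<Rightarrow> (ratfun \<Rightarrow> 'a::{ring, monoid_mult}) \<Rightarrow> 'a \<Rightarrow> 'a \<Rightarrow> 'a fps \<Rightarrow> 'a fps2 tps" where
  "image_y q lq \<eta> e f b = Abs_tps (\<lambda>i n.
     if i = 0 then const2 (\<eta> yvar) + W2 + fps_const b + scalar2 \<eta> (lq * of_int n)
     else scalar2 \<eta> (lq / (q - 1) * (- 1) ^ (i + 1) / (qint q i * q ^ (i * (i - 1) div 2)))
            * ring_inverse (lin_W1 \<eta> e f) ^ i * scalar2 \<eta> (q powi (- (int i * n))))"

definition has_params ::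
  "complex \<Rightarrow> complex \<Rightarrow> (ratfun \<Rightarrow> 'a::{ring, monoid_mult}) \<Rightarrow> (ratfun tps \<Rightarrow> 'a fps2 tps) \<Rightarrow>
     'a \<times> 'a \<times> 'a fps \<Rightarrow> bool" where
  "has_params q lq \<eta> \<phi> = (\<lambda>(e, f, b).
     \<phi> (iota0 q lq tvar) = image_t q \<eta> e f \<and> \<phi> (iota0 q lq yvar) = image_y q lq \<eta> e f b)"

definition the_params ::
  "complex \<Rightarrow> complex \<Rightarrow> (ratfun \<Rightarrow> 'a::{ring, monoid_mult}) \<Rightarrow> (ratfun tps \<Rightarrow> 'a fps2 tps) \<Rightarrow>
     'a \<times> 'a \<times> 'a fps" where
  "the_params q lq \<eta> \<phi> = (THE p. has_params q lq \<eta> \<phi> p)"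

definition to_QG3 ::
  "complex \<Rightarrow> complex \<Rightarrow> (ratfun \<Rightarrow> 'a::{ring, monoid_mult}) \<Rightarrow> (ratfun tps \<Rightarrow> 'a fps2 tps) \<Rightarrow>
     'a mat2 \<times> 'a fps" where
  "to_QG3 q lq \<eta> \<phi> = (case the_params q lq \<eta> \<phi> of (e, f, b) \<Rightarrow> (((e, f), (0, 1)), b))"

definition to_QGIII ::
  "complex \<Rightarrow> complex \<Rightarrow> (ratfun \<Rightarrow> 'a::{ring, monoid_mult}) \<Rightarrow> (ratfun tps \<Rightarrow> 'a fps2 tps) \<Rightarrow>
     'a fps2 \<times> 'a fps2" where
  "to_QGIII q lq \<eta> \<phi> = (case the_params q lq \<eta> \<phi> of (e, f, b) \<Rightarrow> trans_pair \<eta> e f b)"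

text \<open>The operation through the initial conditions: \<open>u \<cdot> \<phi>\<close> corresponds to \<open>u * v\<close> if \<open>\<phi>\<close> corresponds to \<open>v\<close>.\<close>

definition QGIII_act ::
  "complex \<Rightarrow> complex \<Rightarrow> (ratfun \<Rightarrow> 'a::{ring, monoid_mult}) \<Rightarrow> 'a fps2 \<times> 'a fps2 \<Rightarrow>
     (ratfun tps \<Rightarrow> 'a fps2 tps) \<Rightarrow> ratfun tps \<Rightarrow> 'a fps2 tps" where
  "QGIII_act q lq \<eta> u \<phi> =
     inv_into (NCF q lq \<eta>) (to_QGIII q lq \<eta>) (QGIII_prod \<eta> u (to_QGIII q lq \<eta> \<phi>))"

end

theory Submission
  imports Defs
begin

text \<open>
  A deformation \<open>\<phi>\<close> of the Galois hull is governed by the initial values of \<open>\<phi>(\<iota>\<^sub>0(t))\<close> and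
  \<open>\<phi>(\<iota>\<^sub>0(y))\<close>, that is, by their values at \<open>n = 0\<close> in degree \<open>0\<close> of \<open>X\<close>. Compatibility with
  \<open>\<Sigma>\<close> carries a value from \<open>n\<close> to \<open>n + 1\<close>, and compatibility with \<open>\<Theta>\<^sup>(\<^sup>1\<^sup>)\<close> gives the higher
  coefficients, because \<open>\<theta>\<^sup>(\<^sup>1\<^sup>)(t) = 1\<close> and \<open>\<theta>\<^sup>(\<^sup>1\<^sup>)(y)\<close> is a multiple of \<open>t\<^sup>-\<^sup>1\<close>. The derivations
  restrict the initial values to \<open>e (t + W\<^sub>1) + f\<close> and \<open>y + W\<^sub>2 + b(W\<^sub>1)\<close>. The relation
  \<open>Q X = q X Q\<close> in the hull becomes \<open>e f = q f e\<close>, and \<open>t y = y t\<close> becomes the commutation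
  condition on the pair. Conversely the triple \<open>(e, f, b)\<close> determines \<open>\<phi>\<close>: since \<open>\<iota>\<^sub>0\<close> is a ring
  homomorphism, which is the \<open>q\<close>-Leibniz rule (\<open>theta_mult\<close>), \<open>\<phi>\<close> is known on the image under \<open>\<iota>\<^sub>0\<close>
  of the whole field \<open>\<complex>(t, y)\<close>, and hence on the hull (\<open>NCF_eqI\<close>).

  On the side of the groups, \<open>e f = q f e\<close> with \<open>e - 1\<close> nilpotent and \<open>q \<noteq> 1\<close> forces \<open>f = 0\<close>
  (\<open>skew_nilpotent_eq_0\<close>). The commutation condition then says that \<open>e\<close> commutes with every
  coefficient of \<open>b\<close>, both for the matrix form and for the coordinate transformations, so the two
  sets of pairs are in bijection and a bijection onto one is a bijection onto the other.

  The product becomes \<open>(e, b) (g, c) = (e g, b((g - 1) t + g W\<^sub>1) + c)\<close>. The substitution multiplies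
  \<open>t + W\<^sub>1\<close> by \<open>g\<close>, so two substitutions compose by multiplying the parameters, which gives
  associativity (\<open>fps_subst_shift_shift\<close>). The coefficients of \<open>b\<close> may fail to commute with each
  other; the new coefficients are nilpotent nevertheless, because each consists of one nilpotent
  term and multiples of \<open>(g - 1) t\<close>, which is nilpotent and commutes with all that occurs
  (\<open>nilpotent_fps_subst_shift\<close>). The operation on deformations is the product transported along
  the bijection, and everything is natural because a morphism maps initial values to initial
  values.
\<close>

section \<open>The field of rational functions and its automorphism\<close>

lemma cst_simps [simp]:
  "cst 0 = 0" "cst 1 = 1" "cst (a + b) = cst a + cst b" "cst (a * b) = cst a * cst b"
  "cst (- a) = - cst a" "cst (a - b) = cst a - cst b"
  by (simp_all add: cst_def Zero_fract_def One_fract_def one_pCons)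

lemma cst_eq_0_iff [simp]: "cst a = 0 \<longleftrightarrow> a = 0"
  by (simp add: cst_def Zero_fract_def eq_fract)

lemma cst_divide: "cst (a / b) = cst a / cst b"
proof (cases "b = 0")
  case False
  then have "cst (a / b) * cst b = cst a" by (simp flip: cst_simps(4))
  with False show ?thesis by (simp add: eq_divide_eq)
qed simp

lemma cst_power [simp]: "cst (a ^ n) = cst a ^ n"
  by (induction n) simp_all

lemma tvar_neq_0 [simp]: "tvar \<noteq> 0"
  by (simp add: tvar_def Zero_fract_def eq_fract)

text \<open>
  \<open>\<complex>(t, y)\<close> is generated as a field by \<open>\<complex>\<close>, \<open>t\<close> and \<open>y\<close>. This is how statements about \<open>\<sigma>\<close>,
  \<open>\<partial>/\<partial>y\<close> and deformations, all of which respect the field operations, are reduced to the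
  generators.
\<close>

lemma ratfun_induct [case_names cst tvar yvar add mult inverse]:
  assumes "\<And>c. P (cst c)" "P tvar" "P yvar"
    and add: "\<And>a b. P a \<Longrightarrow> P b \<Longrightarrow> P (a + b)"
    and mult: "\<And>a b. P a \<Longrightarrow> P b \<Longrightarrow> P (a * b)"
    and inv: "\<And>a. P a \<Longrightarrow> a \<noteq> 0 \<Longrightarrow> P (inverse a)"
  shows "P x"
proof -
  have inner: "P (Fraction_Field.Fract [:r:] 1)" for r :: "complex poly"
  proof (induction r)
    case 0
    then show ?case using assms(1)[of 0] by (simp add: Zero_fract_def)
  next
    case (pCons c r)
    have "Fraction_Field.Fract [:pCons c r:] 1 = cst c + tvar * Fraction_Field.Fract [:r:] 1"
      by (simp add: cst_def tvar_def)
    then show ?case using add mult assms(1,2) pCons.IH by simp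
  qed
  have outer: "P (Fraction_Field.Fract r 1)" for r :: "complex poly poly"
  proof (induction r)
    case 0
    then show ?case using assms(1)[of 0] by (simp add: Zero_fract_def)
  next
    case (pCons c r)
    have "Fraction_Field.Fract (pCons c r) 1 =
        Fraction_Field.Fract [:c:] 1 + yvar * Fraction_Field.Fract r 1"
      by (simp add: yvar_def)
    then show ?case using add mult assms(3) inner pCons.IH by simp
  qed
  obtain a b where x: "x = Fraction_Field.Fract a b" "b \<noteq> 0" by (cases x) auto
  then have "x = Fraction_Field.Fract a 1 * inverse (Fraction_Field.Fract b 1)" by simp
  moreover have "Fraction_Field.Fract b 1 \<noteq> 0"
    using x by (simp add: Zero_fract_def eq_fract)
  ultimately show ?thesis using mult inv outer by metis
qed

lemma sigma_poly_add: "sigma_poly q lq (a + b) = sigma_poly q lq a + sigma_poly q lq b"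
proof -
  have "map_poly (\<lambda>c. pcompose c [:0, q:]) (a + b) =
      map_poly (\<lambda>c. pcompose c [:0, q:]) a + map_poly (\<lambda>c. pcompose c [:0, q:]) b"
    by (rule poly_eqI) (simp add: coeff_map_poly pcompose_add)
  then show ?thesis by (simp add: sigma_poly_def pcompose_add)
qed

lemma sigma_mult:
  assumes "q \<noteq> 0"
  shows "sigma q lq (a * b) = sigma q lq a * sigma q lq b"
  by (cases a; cases b) (simp add: assms sigma_Fract sigma_poly_mult)

lemma sigma_add:
  assumes "q \<noteq> 0"
  shows "sigma q lq (a + b) = sigma q lq a + sigma q lq b"
proof (cases a; cases b)
  fix p r p' r' :: "complex poly poly"
  assume *: "a = Fraction_Field.Fract p r" "r \<noteq> 0" "b = Fraction_Field.Fract p' r'" "r' \<noteq> 0"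
  then have "sigma_poly q lq r \<noteq> 0" "sigma_poly q lq r' \<noteq> 0"
    using sigma_poly_eq_0 assms by blast+
  with * show ?thesis by (simp add: assms sigma_Fract sigma_poly_mult sigma_poly_add)
qed

lemma sigma_0 [simp]: "q \<noteq> 0 \<Longrightarrow> sigma q lq 0 = 0"
  and sigma_1 [simp]: "q \<noteq> 0 \<Longrightarrow> sigma q lq 1 = 1"
  using sigma_generators(1)[of q lq 0] sigma_generators(1)[of q lq 1] by simp_all

lemma sigma_uminus: "q \<noteq> 0 \<Longrightarrow> sigma q lq (- a) = - sigma q lq a"
  using sigma_add[of q lq a "- a"] by (simp add: eq_neg_iff_add_eq_0 add.commute)

lemma sigma_diff: "q \<noteq> 0 \<Longrightarrow> sigma q lq (a - b) = sigma q lq a - sigma q lq b"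
  using sigma_add[of q lq a "- b"] by (simp add: sigma_uminus)

lemma sigma_eq_0_iff [simp]:
  assumes "q \<noteq> 0"
  shows "sigma q lq a = 0 \<longleftrightarrow> a = 0"
proof
  assume *: "sigma q lq a = 0"
  show "a = 0"
  proof (rule ccontr)
    assume "a \<noteq> 0"
    then have "sigma q lq a * sigma q lq (inverse a) = 1"
      using assms by (simp flip: sigma_mult)
    with * show False by simp
  qed
qed (use assms in simp)

lemma sigma_inverse: "q \<noteq> 0 \<Longrightarrow> sigma q lq (inverse a) = inverse (sigma q lq a)"
proof (cases "a = 0")
  case False
  assume q: "q \<noteq> 0"
  have "sigma q lq a * sigma q lq (inverse a) = 1"
    using False q by (simp flip: sigma_mult)
  then show ?thesis using inverse_unique by metis
qed simp

lemma bij_sigma: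
  assumes q: "q \<noteq> 0"
  shows "bij (sigma q lq)"
proof (rule bijI)
  show "inj (sigma q lq)"
    by (rule injI) (metis eq_iff_diff_eq_0 sigma_diff sigma_eq_0_iff q)
  have "x \<in> range (sigma q lq)" for x
  proof (induction x rule: ratfun_induct)
    case (cst c)
    then show ?case using sigma_generators(1)[OF q] by (metis rangeI)
  next
    case tvar
    have "sigma q lq (cst (1 / q) * tvar) = tvar"
      using q by (simp add: sigma_mult sigma_generators flip: mult.assoc cst_simps(4))
    then show ?case by (metis rangeI)
  next
    case yvar
    have "sigma q lq (yvar - cst lq) = yvar"
      using q by (simp add: sigma_diff sigma_generators)
    then show ?case by (metis rangeI)
  qed (use q in \<open>(force simp flip: sigma_add sigma_mult sigma_inverse)+\<close>)
  then show "surj (sigma q lq)" by blast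
qed

lemma sigma_zpow_0 [simp]: "sigma_zpow q lq 0 a = a"
  by (simp add: sigma_zpow_def)

lemma sigma_zpow_add1:
  assumes "q \<noteq> 0"
  shows "sigma_zpow q lq (n + 1) a = sigma_zpow q lq n (sigma q lq a)"
proof (cases "0 \<le> n")
  case True
  then have "nat (n + 1) = Suc (nat n)" by simp
  with True show ?thesis by (simp add: sigma_zpow_def funpow_swap1 del: nat_add_distrib)
next
  case False
  then have *: "nat (- n) = Suc (nat (- (n + 1)))" by simp
  have "inv (sigma q lq) (sigma q lq a) = a"
    using bij_sigma[OF assms] by (simp add: bij_is_inj)
  then have "sigma_zpow q lq n (sigma q lq a) = (inv (sigma q lq) ^^ nat (- (n + 1))) a"
    using False * by (simp add: sigma_zpow_def funpow_swap1)
  also have "\<dots> = sigma_zpow q lq (n + 1) a"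
    using False by (cases "n = -1") (simp_all add: sigma_zpow_def)
  finally show ?thesis by simp
qed

lemma sigma_zpow_add_nat:
  "q \<noteq> 0 \<Longrightarrow> sigma_zpow q lq (n + int k) a = sigma_zpow q lq n ((sigma q lq ^^ k) a)"
proof (induction k arbitrary: a)
  case (Suc k)
  have "sigma_zpow q lq (n + int (Suc k)) a = sigma_zpow q lq ((n + int k) + 1) a"
    by (simp add: algebra_simps)
  with Suc show ?case by (simp add: sigma_zpow_add1 funpow_swap1)
qed simp

lemma sigma_preimage:
  assumes "q \<noteq> 0"
  obtains a' where "a = sigma q lq a'"
  using bij_sigma[OF assms] by (metis bij_pointE)

text \<open>
  Each negative power is reached by a downward step, in which the arguments are first written
  as images under \<open>\<sigma>\<close>.
\<close>

lemma sigma_zpow_hom: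
  assumes q: "q \<noteq> 0"
  shows "sigma_zpow q lq n (a + b) = sigma_zpow q lq n a + sigma_zpow q lq n b"
    and "sigma_zpow q lq n (a * b) = sigma_zpow q lq n a * sigma_zpow q lq n b"
    and "sigma_zpow q lq n (cst c) = cst c"
proof -
  have "(\<forall>a b. sigma_zpow q lq n (a + b) = sigma_zpow q lq n a + sigma_zpow q lq n b) \<and>
     (\<forall>a b. sigma_zpow q lq n (a * b) = sigma_zpow q lq n a * sigma_zpow q lq n b) \<and>
     (\<forall>c. sigma_zpow q lq n (cst c) = cst c)"
  proof (induction n rule: int_induct[where k = 0])
    case (step1 i)
    then show ?case using q
      by (simp add: sigma_zpow_add1 sigma_add sigma_mult sigma_generators)
  next
    case (step2 i)
    have *: "sigma_zpow q lq i a = sigma_zpow q lq (i - 1) (sigma q lq a)" for a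
      using sigma_zpow_add1[OF q, of lq "i - 1"] by simp
    show ?case
    proof (intro conjI allI)
      fix a b :: ratfun and c
      obtain a' b' where ab: "a = sigma q lq a'" "b = sigma q lq b'"
        using sigma_preimage[OF q] by metis
      show "sigma_zpow q lq (i - 1) (a + b) = sigma_zpow q lq (i - 1) a + sigma_zpow q lq (i - 1) b"
        "sigma_zpow q lq (i - 1) (a * b) = sigma_zpow q lq (i - 1) a * sigma_zpow q lq (i - 1) b"
        using step2 unfolding ab sigma_add[OF q, symmetric] sigma_mult[OF q, symmetric]
          *[symmetric] by auto
      show "sigma_zpow q lq (i - 1) (cst c) = cst c"
        using step2 * sigma_generators(1)[OF q] by metis
    qed
  qed simp
  then show "sigma_zpow q lq n (a + b) = sigma_zpow q lq n a + sigma_zpow q lq n b"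
    "sigma_zpow q lq n (a * b) = sigma_zpow q lq n a * sigma_zpow q lq n b"
    "sigma_zpow q lq n (cst c) = cst c" by blast+
qed

lemma sigma_zpow_tvar:
  assumes q: "q \<noteq> 0"
  shows "sigma_zpow q lq n tvar = cst (q powi n) * tvar"
proof (induction n rule: int_induct[where k = 0])
  case (step1 i)
  then show ?case using q
    by (simp add: sigma_zpow_add1 sigma_generators sigma_zpow_hom power_int_add)
next
  case (step2 i)
  have "cst q * sigma_zpow q lq (i - 1) tvar = sigma_zpow q lq i tvar"
    using sigma_zpow_add1[OF q, of lq "i - 1" tvar] q by (simp add: sigma_generators sigma_zpow_hom)
  also have "\<dots> = cst q * (cst (q powi (i - 1)) * tvar)"
    using step2 q by (simp add: power_int_diff flip: mult.assoc cst_simps(4))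
  finally show ?case using q by simp
qed simp

section \<open>Partial derivative with respect to \<open>y\<close>\<close>

lemma deriv_y_add: "deriv_y (a + b) = deriv_y a + deriv_y b"
proof (cases a; cases b)
  fix p r p' r' :: "complex poly poly"
  assume *: "a = Fraction_Field.Fract p r" "r \<noteq> 0" "b = Fraction_Field.Fract p' r'" "r' \<noteq> 0"
  then show ?thesis
    by (simp add: deriv_y_Fract eq_fract pderiv_mult pderiv_add algebra_simps)
qed

lemma deriv_y_mult: "deriv_y (a * b) = deriv_y a * b + a * deriv_y b"
proof (cases a; cases b)
  fix p r p' r' :: "complex poly poly"
  assume *: "a = Fraction_Field.Fract p r" "r \<noteq> 0" "b = Fraction_Field.Fract p' r'" "r' \<noteq> 0"
  then show ?thesis
    by (simp add: deriv_y_Fract eq_fract pderiv_mult algebra_simps)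
qed

lemma deriv_y_inverse:
  assumes "a \<noteq> 0"
  shows "deriv_y (inverse a) = - deriv_y a * inverse a * inverse a"
proof -
  have "deriv_y (a * inverse a) = 0"
    using assms deriv_generators(4)[of 1] by simp
  then have "a * deriv_y (inverse a) = - (deriv_y a * inverse a)"
    by (simp add: deriv_y_mult eq_neg_iff_add_eq_0 add.commute)
  then have "inverse a * (a * deriv_y (inverse a)) = - (deriv_y a * inverse a) * inverse a"
    by simp
  then show ?thesis using assms by (simp flip: mult.assoc)
qed

lemma deriv_y_cst_mult: "deriv_y (cst c * a) = cst c * deriv_y a"
  by (simp add: deriv_y_mult deriv_generators)

text \<open>
  \<open>\<sigma>\<close> translates \<open>y\<close> by a constant, and \<open>(q - 1) t\<close> does not involve \<open>y\<close>; so \<open>\<partial>/\<partial>y\<close> commutes with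
  \<open>\<sigma>\<close> and with \<open>\<theta>\<^sup>(\<^sup>1\<^sup>)\<close>. This gives \<open>\<partial>/\<partial>y\<close> of all coefficients of \<open>\<iota>\<^sub>0(y)\<close> without computing
  them.
\<close>

lemma deriv_y_sigma:
  assumes q: "q \<noteq> 0"
  shows "deriv_y (sigma q lq a) = sigma q lq (deriv_y a)"
proof (induction a rule: ratfun_induct)
  case (inverse a)
  then show ?case using q
    by (simp add: sigma_mult sigma_inverse sigma_uminus deriv_y_inverse)
qed (use q in \<open>simp_all add: sigma_generators sigma_add sigma_mult deriv_generators deriv_y_add
      deriv_y_mult\<close>)

lemma deriv_y_theta1:
  assumes q: "q \<noteq> 0"
  shows "deriv_y (theta1 q lq a) = theta1 q lq (deriv_y a)"
proof -
  define d where "d = inverse (cst (q - 1) * tvar)"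
  have "deriv_y (cst (q - 1) * tvar) = 0"
    by (simp only: deriv_y_cst_mult deriv_generators mult_zero_right)
  then have "deriv_y d = 0"
    using deriv_y_inverse[of "cst (q - 1) * tvar"] unfolding d_def
    by (cases "cst (q - 1) * tvar = 0") simp_all
  moreover have "theta1 q lq x = (sigma q lq x - x) * d" for x
    by (simp only: theta1_def d_def divide_inverse)
  ultimately show ?thesis
    using deriv_y_add[of "sigma q lq a" "- a"] deriv_y_cst_mult[of "- 1" a]
    by (simp add: deriv_y_mult deriv_y_sigma[OF q])
qed

lemma deriv_y_sigma_zpow:
  assumes q: "q \<noteq> 0"
  shows "deriv_y (sigma_zpow q lq n a) = sigma_zpow q lq n (deriv_y a)"
proof (induction n arbitrary: a rule: int_induct[where k = 0])
  case (step1 i)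
  then show ?case using q by (simp add: sigma_zpow_add1 deriv_y_sigma)
next
  case (step2 i)
  obtain a' where a: "a = sigma q lq a'" using sigma_preimage[OF q] .
  have "sigma_zpow q lq (i - 1) (sigma q lq x) = sigma_zpow q lq i x" for x
    using sigma_zpow_add1[OF q, of lq "i - 1"] by simp
  then show ?case by (simp add: a deriv_y_sigma[OF q] step2)
qed simp

section \<open>The \<open>q\<close>-Leibniz rule\<close>

lemma qint_add: "qint q (m + n) = qint q m + q ^ m * qint q n"
  by (induction n) (simp_all add: qint_def power_add algebra_simps)

lemma qint_neq_0:
  assumes "\<And>n. n > 0 \<Longrightarrow> q ^ n \<noteq> 1" "n > 0"
  shows "qint q n \<noteq> 0"
proof
  assume "qint q n = 0"
  then have "(q - 1) * (\<Sum>i<n. q ^ i) = 0" by (simp add: qint_def)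
  then have "q ^ n - 1 = 0" by (simp only: power_diff_1_eq)
  with assms show False by simp
qed

lemma qfact_0 [simp]: "qfact q 0 = 1" and qfact_Suc: "qfact q (Suc n) = qfact q n * qint q (Suc n)"
  by (simp_all add: qfact_def)

lemma qint_simps [simp]: "qint q 0 = 0" "qint q (Suc 0) = 1"
  by (simp_all add: qint_def)

lemma qfact_neq_0: "(\<And>n. n > 0 \<Longrightarrow> q ^ n \<noteq> 1) \<Longrightarrow> qfact q n \<noteq> 0"
  by (induction n) (simp_all add: qfact_Suc qint_neq_0)

locale q_generic =
  fixes q lq :: complex
  assumes q_neq_0: "q \<noteq> 0" and q_power_neq_1: "\<And>n. n > 0 \<Longrightarrow> q ^ n \<noteq> 1"
begin

abbreviation "\<sigma> \<equiv> sigma q lq"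
abbreviation "\<theta> \<equiv> theta q lq"
abbreviation "\<theta>1 \<equiv> theta1 q lq"

lemma q_neq_1: "q \<noteq> 1"
  using q_power_neq_1[of 1] by simp

lemmas qint_Suc_neq_0 [simp] = qint_neq_0[OF q_power_neq_1 zero_less_Suc]
lemmas qfact_neq_0' [simp] = qfact_neq_0[OF q_power_neq_1]

lemma theta1_add: "\<theta>1 (a + b) = \<theta>1 a + \<theta>1 b"
  by (simp add: theta1_def sigma_add q_neq_0 diff_divide_distrib add_divide_distrib)

lemma theta1_mult: "\<theta>1 (a * b) = \<theta>1 a * b + \<sigma> a * \<theta>1 b"
proof -
  have "\<sigma> (a * b) - a * b = (\<sigma> a - a) * b + \<sigma> a * (\<sigma> b - b)"
    by (simp add: sigma_mult q_neq_0 algebra_simps)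
  then show ?thesis by (simp add: theta1_def add_divide_distrib)
qed

lemma theta1_cst [simp]: "\<theta>1 (cst c) = 0"
  by (simp add: theta1_def sigma_generators q_neq_0)

lemma theta1_cst_mult: "\<theta>1 (cst c * a) = cst c * \<theta>1 a"
  by (simp add: theta1_mult sigma_generators q_neq_0)

lemma theta1_sum: "\<theta>1 (\<Sum>i\<in>I. f i) = (\<Sum>i\<in>I. \<theta>1 (f i))"
  using theta1_cst[of 0]
  by (induction I rule: infinite_finite_induct) (simp_all add: theta1_add)

text \<open>
  The factor \<open>q\<close> comes from the denominator \<open>(q - 1) t\<close>, on which \<open>\<sigma>\<close> acts as multiplication
  by \<open>q\<close>. Moving \<open>\<theta>\<^sup>(\<^sup>1\<^sup>)\<close> past \<open>\<sigma>\<^sup>n\<close> costs \<open>q\<^sup>n\<close>, and this is what turns binomial coefficients into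
  \<open>q\<close>-binomial ones.
\<close>

lemma theta1_sigma: "\<theta>1 (\<sigma> a) = cst q * \<sigma> (\<theta>1 a)"
proof -
  have "\<sigma> (\<theta>1 a) = (\<sigma> (\<sigma> a) - \<sigma> a) / (cst (q - 1) * (cst q * tvar))"
    by (simp only: theta1_def divide_inverse sigma_mult[OF q_neq_0] sigma_inverse[OF q_neq_0]
        sigma_diff[OF q_neq_0] sigma_generators[OF q_neq_0])
  then show ?thesis using q_neq_0 by (simp add: theta1_def)
qed

lemma theta1_sigma_funpow: "\<theta>1 ((\<sigma> ^^ n) a) = cst (q ^ n) * (\<sigma> ^^ n) (\<theta>1 a)"
proof (induction n)
  case (Suc n)
  have "\<theta>1 ((\<sigma> ^^ Suc n) a) = cst q * \<sigma> (cst (q ^ n) * (\<sigma> ^^ n) (\<theta>1 a))"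
    by (simp add: theta1_sigma Suc)
  also have "\<dots> = cst (q ^ Suc n) * (\<sigma> ^^ Suc n) (\<theta>1 a)"
    by (simp only: sigma_mult[OF q_neq_0] sigma_generators[OF q_neq_0] power_Suc cst_simps(4)
        funpow.simps comp_apply mult.assoc)
  finally show ?case .
qed simp

lemma sigma_funpow_cst_mult: "(\<sigma> ^^ n) (cst c * a) = cst c * (\<sigma> ^^ n) a"
  by (induction n) (simp_all add: sigma_mult sigma_generators q_neq_0)

lemma theta_0 [simp]: "\<theta> 0 a = a"
  by (simp add: theta_def)

lemma theta_1: "\<theta> (Suc 0) a = \<theta>1 a"
  by (simp add: theta_def qfact_Suc)

lemma theta1_theta: "\<theta>1 (\<theta> n a) = cst (qint q (Suc n)) * \<theta> (Suc n) a"
proof -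
  have "qint q (Suc n) * (1 / qfact q (Suc n)) = 1 / qfact q n"
    by (simp add: qfact_Suc)
  then show ?thesis
    by (simp add: theta_def theta1_cst_mult flip: mult.assoc cst_simps(4))
qed

lemma theta_Suc: "\<theta> (Suc n) a = cst (1 / qint q (Suc n)) * \<theta>1 (\<theta> n a)"
  by (simp add: theta1_theta flip: mult.assoc cst_simps(4))

lemma theta_Suc': "\<theta> (Suc n) a = cst (1 / qint q (Suc n)) * \<theta> n (\<theta>1 a)"
  by (simp add: theta_def funpow_swap1 qfact_Suc mult.commute flip: mult.assoc cst_simps(4))

lemma theta_add: "\<theta> n (a + b) = \<theta> n a + \<theta> n b"
  by (induction n) (simp_all add: theta_Suc theta1_add distrib_left)

lemma theta_Suc_cst [simp]: "\<theta> (Suc n) (cst c) = 0"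
  using theta1_cst[of 0] by (induction n) (simp_all add: theta_Suc)

lemma theta_cst: "\<theta> n (cst c) = (if n = 0 then cst c else 0)"
  by (cases n) simp_all

lemma theta_sigma: "\<theta> n (\<sigma> a) = cst (q ^ n) * \<sigma> (\<theta> n a)"
proof (induction n)
  case (Suc n)
  then show ?case
    by (simp add: theta_Suc theta1_cst_mult theta1_sigma sigma_mult sigma_generators q_neq_0
        del: cst_power)
qed simp

lemma qbinom_1: "qbinom q (Suc i) (Suc 0) = qint q (Suc i)"
  by (simp add: qbinom_def qfact_Suc)

lemma theta_theta: "\<theta> i (\<theta> l a) = cst (qbinom q (i + l) l) * \<theta> (i + l) a"
proof (induction i)
  case 0
  then show ?case by (simp add: qbinom_def)
next
  case (Suc i)
  have "1 / qint q (Suc i) * (qbinom q (i + l) l * qint q (Suc (i + l))) = qbinom q (Suc i + l) l"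
    by (simp add: qbinom_def qfact_Suc)
  then show ?case
    by (simp add: theta_Suc[of i] Suc theta1_cst_mult theta1_theta flip: mult.assoc cst_simps(4))
qed

text \<open>
  Applying \<open>\<theta>\<^sup>(\<^sup>1\<^sup>)\<close> to the formula for \<open>k\<close> produces the term with index \<open>i\<close> of the formula for
  \<open>k + 1\<close> twice, with factors \<open>q\<^bsup>k+1-i\<^esup>[i]\<close> and \<open>[k + 1 - i]\<close>, whose sum is \<open>[k + 1]\<close>.
\<close>

lemma theta_mult: "\<theta> k (a * b) = (\<Sum>i=0..k. (\<sigma> ^^ (k - i)) (\<theta> i a) * \<theta> (k - i) b)"
proof (induction k)
  case (Suc k)
  define f where "f i = (\<sigma> ^^ (Suc k - i)) (\<theta> i a) * \<theta> (Suc k - i) b" for i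
  have "\<theta>1 (\<theta> k (a * b)) = (\<Sum>i=0..k. \<theta>1 ((\<sigma> ^^ (k - i)) (\<theta> i a)) * \<theta> (k - i) b +
      \<sigma> ((\<sigma> ^^ (k - i)) (\<theta> i a)) * \<theta>1 (\<theta> (k - i) b))"
    unfolding Suc theta1_sum theta1_mult ..
  also have "\<dots> = (\<Sum>i=0..k. cst (q ^ (k - i) * qint q (Suc i)) * f (Suc i)) +
      (\<Sum>i=0..k. cst (qint q (Suc k - i)) * f i)"
    unfolding sum.distrib
  proof (intro arg_cong2[of _ _ _ _ "(+)"] sum.cong refl)
    fix i assume "i \<in> {0..k}"
    then have [simp]: "Suc k - i = Suc (k - i)" by auto
    show "\<theta>1 ((\<sigma> ^^ (k - i)) (\<theta> i a)) * \<theta> (k - i) b =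
        cst (q ^ (k - i) * qint q (Suc i)) * f (Suc i)"
      by (simp add: theta1_sigma_funpow theta1_theta sigma_funpow_cst_mult f_def)
    show "\<sigma> ((\<sigma> ^^ (k - i)) (\<theta> i a)) * \<theta>1 (\<theta> (k - i) b) = cst (qint q (Suc k - i)) * f i"
      by (simp add: theta1_theta f_def)
  qed
  also have "(\<Sum>i=0..k. cst (q ^ (k - i) * qint q (Suc i)) * f (Suc i)) =
      (\<Sum>i=0..Suc k. cst (q ^ (Suc k - i) * qint q i) * f i)"
    unfolding sum.atLeast0_atMost_Suc_shift by simp
  also have "(\<Sum>i=0..k. cst (qint q (Suc k - i)) * f i) =
      (\<Sum>i=0..Suc k. cst (qint q (Suc k - i)) * f i)"
    by simp
  also have "(\<Sum>i=0..Suc k. cst (q ^ (Suc k - i) * qint q i) * f i) +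
      (\<Sum>i=0..Suc k. cst (qint q (Suc k - i)) * f i) = (\<Sum>i=0..Suc k. cst (qint q (Suc k)) * f i)"
    unfolding sum.distrib[symmetric]
  proof (intro sum.cong refl)
    fix i assume "i \<in> {0..Suc k}"
    then have "qint q (Suc k) = q ^ (Suc k - i) * qint q i + qint q (Suc k - i)"
      using qint_add[of q "Suc k - i" i] by simp
    then show "cst (q ^ (Suc k - i) * qint q i) * f i + cst (qint q (Suc k - i)) * f i =
        cst (qint q (Suc k)) * f i"
      by (simp add: distrib_right)
  qed
  finally have "\<theta>1 (\<theta> k (a * b)) = cst (qint q (Suc k)) * (\<Sum>i=0..Suc k. f i)"
    by (simp only: sum_distrib_left)
  then show ?case
    unfolding theta_Suc f_def by (simp flip: mult.assoc cst_simps(4))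
qed simp

end

section \<open>Arithmetic of twisted power series\<close>

lemma tps_nth_simps [simp]:
  "tps_nth 0 i n = 0"
  "tps_nth (F + G) i n = tps_nth F i n + tps_nth G i n"
  "tps_nth (F - G) i n = tps_nth F i n - tps_nth G i n"
  "tps_nth 1 i n = (if i = 0 then 1 else 0)"
  "tps_nth (tps_fun a) i n = (if i = 0 then a n else 0)"
  "tps_nth (tps_const c) i n = (if i = 0 then c else 0)"
  "tps_nth tps_X i n = (if i = 1 then 1 else 0)"
  "tps_nth (map_tps h F) i n = h (tps_nth F i n)"
  "tps_nth (hat_Sigma s q F) i n = s (q ^ i) * tps_nth F i (n + 1)"
  "tps_nth (hat_Theta s q l F) i n = s (qbinom q (i + l) l) * tps_nth F (i + l) n"
  by (simp_all add: zero_tps_def plus_tps_def minus_tps_def one_tps_def tps_fun_def tps_const_def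
      tps_X_def map_tps_def hat_Sigma_def hat_Theta_def)

lemma tps_nth_mult:
  "tps_nth (F * G) k n = (\<Sum>i=0..k. tps_nth F i (n + int (k - i)) * tps_nth G (k - i) n)"
  by (simp add: times_tps_def)

lemma tps_nth_mult_0 [simp]: "tps_nth (F * G) 0 n = tps_nth F 0 n * tps_nth G 0 n"
  by (simp add: tps_nth_mult)

lemma tps_nth_fun_mult [simp]:
  "tps_nth (tps_fun a * F) k n = a (n + int k) * tps_nth F k n"
  "tps_nth (F * tps_fun a) k n = tps_nth F k n * a n"
proof -
  have "tps_nth (tps_fun a * F) k n = (\<Sum>i=0..k. if i = 0 then a (n + int k) * tps_nth F k n else 0)"
    unfolding tps_nth_mult by (intro sum.cong) auto
  then show "tps_nth (tps_fun a * F) k n = a (n + int k) * tps_nth F k n" by simp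
  have "tps_nth (F * tps_fun a) k n = (\<Sum>i=0..k. if i = k then tps_nth F k n * a n else 0)"
    unfolding tps_nth_mult by (intro sum.cong) auto
  then show "tps_nth (F * tps_fun a) k n = tps_nth F k n * a n" by simp
qed

lemma tps_nth_const_mult [simp]:
  "tps_nth (tps_const c * F) k n = c * tps_nth F k n"
  "tps_nth (F * tps_const c) k n = tps_nth F k n * c"
  by (simp_all add: tps_const_def)

lemma tps_nth_X_mult [simp]:
  fixes F :: "'b::{ring, monoid_mult} tps"
  shows "tps_nth (tps_X * F) k n = (if k = 0 then 0 else tps_nth F (k - 1) n)"
    and "tps_nth (F * tps_X) k n = (if k = 0 then 0 else tps_nth F (k - 1) (n + 1))"
proof -
  have "tps_nth (tps_X * F) k n = (\<Sum>i=0..k. if i = 1 then tps_nth F (k - 1) n else 0)"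
    unfolding tps_nth_mult by (intro sum.cong) auto
  then show "tps_nth (tps_X * F) k n = (if k = 0 then 0 else tps_nth F (k - 1) n)" by auto
  have "tps_nth (F * tps_X) k n =
      (\<Sum>i=0..k. if i = k - 1 then (if k = 0 then 0 else tps_nth F (k - 1) (n + 1)) else 0)"
    unfolding tps_nth_mult by (intro sum.cong) auto
  then show "tps_nth (F * tps_X) k n = (if k = 0 then 0 else tps_nth F (k - 1) (n + 1))" by simp
qed

lemma tps_const_0 [simp]: "tps_const 0 = 0" and tps_const_1 [simp]: "tps_const 1 = 1"
  by (rule tps_eqI; simp)+

section \<open>The universal Hopf morphism\<close>

context q_generic
begin

abbreviation "\<iota>0 \<equiv> iota0 q lq"

lemma iota0_nth [simp]: "tps_nth (\<iota>0 a) i n = sigma_zpow q lq n (\<theta> i a)"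
  by (simp add: iota0_def)

lemma sigma_zpow_simps [simp]:
  "sigma_zpow q lq n (a + b) = sigma_zpow q lq n a + sigma_zpow q lq n b"
  "sigma_zpow q lq n (a * b) = sigma_zpow q lq n a * sigma_zpow q lq n b"
  "sigma_zpow q lq n (cst c) = cst c"
  "sigma_zpow q lq n tvar = cst (q powi n) * tvar"
  by (simp_all add: sigma_zpow_hom sigma_zpow_tvar q_neq_0)

lemma sigma_zpow_01 [simp]: "sigma_zpow q lq n 0 = 0" "sigma_zpow q lq n 1 = 1"
  using sigma_zpow_simps(3)[of n 0] sigma_zpow_simps(3)[of n 1] by simp_all

lemma sigma_zpow_sum: "sigma_zpow q lq n (\<Sum>i\<in>I. f i) = (\<Sum>i\<in>I. sigma_zpow q lq n (f i))"
  by (induction I rule: infinite_finite_induct) simp_all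

lemma iota0_add: "\<iota>0 (a + b) = \<iota>0 a + \<iota>0 b"
  by (rule tps_eqI) (simp add: theta_add)

text \<open>
  The twist \<open>a X = X \<Sigma>(a)\<close> is made for this: the product of two series is the right-hand side
  of the \<open>q\<close>-Leibniz rule.
\<close>

lemma iota0_mult: "\<iota>0 (a * b) = \<iota>0 a * \<iota>0 b"
  by (rule tps_eqI) (simp add: theta_mult tps_nth_mult sigma_zpow_sum sigma_zpow_add_nat q_neq_0
      del: of_nat_diff)

lemma iota0_cst: "\<iota>0 (cst c) = tps_const (cst c)"
  by (rule tps_eqI) (simp add: theta_cst)

lemma iota0_1: "\<iota>0 1 = 1"
  using iota0_cst[of 1] by simp

lemma hat_Sigma_iota0: "hat_Sigma cst q (\<iota>0 a) = \<iota>0 (\<sigma> a)"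
  by (rule tps_eqI) (simp add: theta_sigma sigma_zpow_add1 q_neq_0 flip: cst_power)

lemma hat_Theta_iota0: "hat_Theta cst q l (\<iota>0 a) = \<iota>0 (\<theta> l a)"
  by (rule tps_eqI) (simp add: theta_theta)

lemma theta1_tvar: "\<theta>1 tvar = 1"
proof -
  have "\<sigma> tvar - tvar = cst (q - 1) * tvar"
    by (simp add: sigma_generators q_neq_0 left_diff_distrib)
  moreover have "cst (q - 1) * tvar \<noteq> 0"
    using q_neq_1 cst_eq_0_iff[of "q - 1"] by (simp del: cst_simps cst_eq_0_iff)
  ultimately show ?thesis by (simp add: theta1_def)
qed

lemma theta1_yvar: "\<theta>1 yvar = cst (lq / (q - 1)) * inverse tvar"
  by (simp add: theta1_def sigma_generators q_neq_0 cst_divide del: cst_simps(6))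
    (simp add: field_simps del: cst_simps(6))

definition Qseries :: "ratfun tps"
  where "Qseries = tps_fun (\<lambda>n. cst (q powi n))"

lemma theta_tvar: "\<theta> i tvar = (if i = 0 then tvar else if i = 1 then 1 else 0)"
proof -
  have "\<theta> (Suc (Suc j)) tvar = 0" for j
    using theta_Suc_cst[of j 1] by (simp add: theta_Suc'[of "Suc j"] theta1_tvar)
  moreover have "\<theta> (Suc 0) tvar = 1" by (simp add: theta_1 theta1_tvar)
  moreover have "i = 0 \<or> i = 1 \<or> (\<exists>j. i = Suc (Suc j))" by presburger
  ultimately show ?thesis by auto
qed

lemma iota0_tvar: "\<iota>0 tvar = tps_const tvar * Qseries + tps_X"
  by (rule tps_eqI) (auto simp add: theta_tvar Qseries_def)

lemma deriv_cst_simps [simp]: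
  "deriv_t 0 = 0" "deriv_t 1 = 0" "deriv_y 0 = 0" "deriv_y 1 = 0"
  using deriv_generators(1)[of 0] deriv_generators(1)[of 1]
    deriv_generators(4)[of 0] deriv_generators(4)[of 1] by simp_all

lemma deriv_t_cst_tvar: "deriv_t (cst c * tvar) = cst c"
proof -
  have "cst c * tvar = Fraction_Field.Fract [:[:0, c:]:] 1"
    by (simp add: cst_def tvar_def)
  then show ?thesis
    by (simp add: deriv_t_Fract cst_def map_poly_pCons pderiv_pCons one_pCons)
qed

lemma deriv_iota0_tvar:
  "map_tps deriv_t (\<iota>0 tvar) = Qseries" "map_tps deriv_y (\<iota>0 tvar) = 0"
  by (rule tps_eqI; simp add: theta_tvar Qseries_def deriv_t_cst_tvar deriv_y_cst_mult
      deriv_generators)+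

lemma deriv_Qseries: "map_tps deriv_t Qseries = 0" "map_tps deriv_y Qseries = 0"
  by (rule tps_eqI; simp add: Qseries_def deriv_generators)+

lemma deriv_y_theta: "deriv_y (\<theta> i a) = \<theta> i (deriv_y a)"
  by (induction i) (simp_all add: theta_Suc deriv_y_cst_mult deriv_y_theta1 q_neq_0)

lemma deriv_y_iota0_yvar: "map_tps deriv_y (\<iota>0 yvar) = 1"
  using theta_cst[of _ 1]
  by (intro tps_eqI) (simp add: deriv_y_sigma_zpow q_neq_0 deriv_y_theta deriv_generators)

abbreviation "\<G> \<equiv> galois_hull q lq"

lemma hull_1: "1 \<in> \<G>"
  using galois_hull.const[of 1] by simp

lemma hull_Qseries: "Qseries \<in> \<G>"
  by (metis deriv_iota0_tvar(1) galois_hull.deriv_t galois_hull.iota0)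

text \<open>
  Both summands of \<open>\<iota>\<^sub>0(t) = t Q + X\<close> are available in the hull, since \<open>Q\<close> is
  \<open>\<partial>/\<partial>t\<close> of \<open>\<iota>\<^sub>0(t)\<close>. Their commutation rule is what a deformation transports to its
  parameters.
\<close>

lemma hull_X: "tps_X \<in> \<G>"
proof -
  have "tps_X = \<iota>0 tvar + tps_const (- tvar) * Qseries"
    by (rule tps_eqI) (simp add: iota0_tvar del: iota0_nth)
  then show ?thesis
    using galois_hull.add[OF galois_hull.iota0 galois_hull.mult[OF galois_hull.const hull_Qseries]]
    by metis
qed

lemma Qseries_X: "Qseries * tps_X = tps_const (cst q) * (tps_X * Qseries)"
  by (rule tps_eqI) (simp add: Qseries_def power_int_add q_neq_0 mult.commute)

end

section \<open>Power series over a noncommutative algebra\<close>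

lemma const2_nth: "const2 a $ m $ n = (if m = 0 \<and> n = 0 then a else 0)"
  by (simp add: const2_def)

lemma W1_nth: "W1 $ m $ n = (if m = 0 \<and> n = 1 then 1 else 0)"
  by (simp add: W1_def fps_X_def)

lemma W2_nth: "W2 $ m $ n = (if m = 1 \<and> n = 0 then 1 else 0)"
  by (simp add: W2_def fps_X_def)

lemma fps2_eqI: "(\<And>m n. F $ m $ n = G $ m $ n) \<Longrightarrow> F = (G :: 'a fps2)"
  by (simp add: fps_eq_iff)

lemma const2_mult_nth [simp]:
  fixes a :: "'a::{ring, monoid_mult}"
  shows "(const2 a * F) $ m $ n = a * F $ m $ n" "(F * const2 a) $ m $ n = F $ m $ n * a"
  by (simp_all add: const2_def)

lemma const2_simps [simp]:
  fixes a b :: "'a::{ring, monoid_mult}"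
  shows "const2 0 = (0 :: 'a fps2)" "const2 1 = (1 :: 'a fps2)"
    "const2 (a + b) = const2 a + const2 b" "const2 (a - b) = const2 a - const2 b"
    "const2 (a * b) = const2 a * const2 b"
  by (simp_all add: const2_def)

locale nc_alg = q_generic +
  fixes \<eta> :: "ratfun \<Rightarrow> 'a::{ring, monoid_mult}"
  assumes nc_algebra: "nc_algebra \<eta>"
begin

lemma eta_simps [simp]: "\<eta> 1 = 1" "\<eta> (x + y) = \<eta> x + \<eta> y" "\<eta> (x * y) = \<eta> x * \<eta> y"
  using nc_algebra unfolding nc_algebra_def by blast+

lemma eta_central: "a * \<eta> x = \<eta> x * a"
  using nc_algebra unfolding nc_algebra_def by simp

lemma eta_0 [simp]: "\<eta> 0 = 0"
  using eta_simps(2)[of 0 0] by (simp del: eta_simps)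

lemma eta_left_commute: "a * (\<eta> x * c) = \<eta> x * (a * c)"
  by (metis eta_central mult.assoc)

lemma eta_uminus: "\<eta> (- x) = - \<eta> x"
  using eta_simps(2)[of "- x" x] by (simp add: eq_neg_iff_add_eq_0 del: eta_simps)

lemma eta_inverse_cancel: "x \<noteq> 0 \<Longrightarrow> \<eta> (inverse x) * (\<eta> x * a) = a"
  by (simp flip: mult.assoc eta_simps(3))

abbreviation "sc c \<equiv> \<eta> (cst c)"
abbreviation "scalar c \<equiv> scalar2 \<eta> c"

lemma sc_of_nat: "sc (of_nat n) * x = (\<Sum>i<n. x)"
  by (induction n) (simp_all add: distrib_right add.commute)

lemma sc_cancel: "c \<noteq> 0 \<Longrightarrow> sc c * x = 0 \<longleftrightarrow> x = 0"
  using eta_inverse_cancel[of "cst c" x] by auto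

lemma scalar_simps [simp]:
  "scalar 0 = 0" "scalar 1 = 1" "scalar (a + b) = scalar a + scalar b"
  "scalar (a * b) = scalar a * scalar b"
  by (simp_all add: scalar2_def)

lemma scalar_nth [simp]: "(scalar c * F) $ m $ n = sc c * F $ m $ n"
  by (simp add: scalar2_def)

lemma scalar_central: "F * scalar c = scalar c * F"
  by (rule fps2_eqI) (simp add: scalar2_def eta_central)

lemma scalar_left_commute: "F * (scalar c * G) = scalar c * (F * G)"
  by (metis mult.assoc scalar_central)

lemma scalar_scalar: "scalar a * (scalar b * F) = scalar (a * b) * F"
  by (simp add: mult.assoc)

lemma scalar_solve: "c \<noteq> 0 \<Longrightarrow> scalar c * F = G \<Longrightarrow> F = scalar (1 / c) * G"
  by (auto simp: scalar_scalar simp del: scalar_simps(4))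

lemma deriv_W1_nth: "deriv_W1 F $ m $ n = sc (of_nat (Suc n)) * (F $ m $ Suc n :: 'a)"
  unfolding sc_of_nat deriv_W1_def by simp

lemma deriv_W2_nth: "deriv_W2 F $ m $ n = sc (of_nat (Suc m)) * (F $ Suc m $ n :: 'a)"
  unfolding sc_of_nat deriv_W2_def by simp

text \<open>Positive integers are invertible in the algebra, so a vanishing derivative kills coefficients.\<close>

lemma deriv_W1_eq_0D: "deriv_W1 F = 0 \<Longrightarrow> F $ m $ Suc n = (0 :: 'a)"
  using deriv_W1_nth[of F m n] sc_cancel[of "of_nat (Suc n)" "F $ m $ Suc n"]
  by (simp del: of_nat_Suc)

lemma deriv_W2_eq_0D: "deriv_W2 F = 0 \<Longrightarrow> F $ Suc m $ n = (0 :: 'a)"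
  using deriv_W2_nth[of F m n] sc_cancel[of "of_nat (Suc m)" "F $ Suc m $ n"]
  by (simp del: of_nat_Suc)

lemma funpow_fixed_0: "f 0 = 0 \<Longrightarrow> (f ^^ n) 0 = 0"
  for f :: "ratfun \<Rightarrow> ratfun"
  by (induction n) simp_all

lemma taylor_nth:
  "taylor \<eta> a $ m $ n = \<eta> (cst (1 / (fact n * fact m)) * (deriv_t ^^ n) ((deriv_y ^^ m) a))"
  by (simp add: taylor_def)

lemma taylor_cst: "taylor \<eta> (cst c) = scalar c"
proof (rule fps2_eqI)
  fix m n
  show "taylor \<eta> (cst c) $ m $ n = scalar c $ m $ n"
    by (cases m; cases n) (simp_all add: taylor_nth scalar2_def const2_nth deriv_generators
        funpow_fixed_0 funpow_swap1 del: eta_simps)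
qed

lemma taylor_0 [simp]: "taylor \<eta> 0 = 0"
  using taylor_cst[of 0] by simp

lemma taylor_tvar: "taylor \<eta> tvar = const2 (\<eta> tvar) + W1"
proof (rule fps2_eqI)
  fix m n :: nat
  have "n = 0 \<or> n = 1 \<or> (\<exists>k. n = Suc (Suc k))" by presburger
  then show "taylor \<eta> tvar $ m $ n = (const2 (\<eta> tvar) + W1) $ m $ n"
    by (cases m) (auto simp add: taylor_nth const2_nth W1_nth deriv_generators
        funpow_fixed_0 funpow_swap1 simp del: eta_simps(2-))
qed

lemma taylor_yvar: "taylor \<eta> yvar = const2 (\<eta> yvar) + W2"
proof (rule fps2_eqI)
  fix m n :: nat
  have "m = 0 \<or> m = 1 \<or> (\<exists>k. m = Suc (Suc k))" by presburger
  then show "taylor \<eta> yvar $ m $ n = (const2 (\<eta> yvar) + W2) $ m $ n"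
    by (cases n) (auto simp add: taylor_nth const2_nth W2_nth deriv_generators
        funpow_fixed_0 funpow_swap1 simp del: eta_simps(2-))
qed

end

section \<open>The shape of a deformation\<close>

context nc_alg
begin

lemma lin_W1_nth:
  "lin_W1 \<eta> e f $ m $ n =
     (if m = 0 \<and> n = 0 then e * \<eta> tvar + f else if m = 0 \<and> n = 1 then e else 0)"
  by (simp add: lin_W1_def const2_nth W1_nth)

lemma scalar_minus_1: "scalar (- 1) * F = - F"
proof -
  have "scalar (- 1) * F + F = scalar (- 1 + 1) * F"
    unfolding scalar_simps(3) by (simp add: distrib_right)
  then show ?thesis by (simp add: eq_neg_iff_add_eq_0)
qed

lemma scalar_powi_rec:
  assumes rec: "\<And>n. f (n + 1) = scalar c * f n" and c: "c \<noteq> 0"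
  shows "f n = scalar (c powi n) * f 0"
proof (induction n rule: int_induct[where k = 0])
  case (step1 i)
  then show ?case
    by (simp add: rec scalar_scalar power_int_add c mult.commute del: scalar_simps(4))
next
  case (step2 i)
  have "scalar c * f (i - 1) = f i"
    using rec[of "i - 1"] by simp
  then have "f (i - 1) = scalar (1 / c) * f i"
    by (rule scalar_solve[OF c])
  then show ?case
    by (simp add: step2 scalar_scalar power_int_diff c del: scalar_simps(4))
qed simp

context
  fixes \<phi>
  assumes \<phi>: "\<phi> \<in> NCF q lq \<eta>"
begin

lemma phi_add: "F \<in> \<G> \<Longrightarrow> G \<in> \<G> \<Longrightarrow> \<phi> (F + G) = \<phi> F + \<phi> G"
  and phi_mult: "F \<in> \<G> \<Longrightarrow> G \<in> \<G> \<Longrightarrow> \<phi> (F * G) = \<phi> F * \<phi> G"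
  and phi_Sigma: "F \<in> \<G> \<Longrightarrow> \<phi> (hat_Sigma cst q F) = hat_Sigma (scalar2 \<eta>) q (\<phi> F)"
  and phi_Theta: "F \<in> \<G> \<Longrightarrow> \<phi> (hat_Theta cst q l F) = hat_Theta (scalar2 \<eta>) q l (\<phi> F)"
  and phi_deriv_t: "F \<in> \<G> \<Longrightarrow> \<phi> (map_tps deriv_t F) = map_tps deriv_W1 (\<phi> F)"
  and phi_deriv_y: "F \<in> \<G> \<Longrightarrow> \<phi> (map_tps deriv_y F) = map_tps deriv_W2 (\<phi> F)"
  and phi_nilpotent: "F \<in> \<G> \<Longrightarrow> nilpotent (tps_nth (\<phi> F - iota \<eta> F) i n $ m $ k)"
  and phi_1: "\<phi> 1 = 1"
  using \<phi> unfolding NCF_def by blast+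

lemma phi_const: "\<phi> (tps_const a) = tps_const (taylor \<eta> a)"
proof -
  have "\<phi> (tps_const a) = iota \<eta> (tps_const a)"
    using \<phi> unfolding NCF_def by blast
  then show ?thesis by (auto simp add: iota_def intro: tps_eqI)
qed

lemma phi_0: "\<phi> 0 = 0"
  using phi_const[of 0] by simp

lemma phi_iota0_sigma: "\<phi> (\<iota>0 (\<sigma> a)) = hat_Sigma (scalar2 \<eta>) q (\<phi> (\<iota>0 a))"
  using phi_Sigma[OF galois_hull.iota0] by (simp add: hat_Sigma_iota0)

lemma phi_iota0_theta1:
  "tps_nth (\<phi> (\<iota>0 (\<theta>1 a))) i n = scalar (qint q (Suc i)) * tps_nth (\<phi> (\<iota>0 a)) (Suc i) n"
  using phi_Theta[OF galois_hull.iota0, of 1] by (simp add: hat_Theta_iota0 theta_1 qbinom_1)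

lemma phi_iota0_cst: "\<phi> (\<iota>0 (cst c)) = tps_const (scalar c)"
  by (simp add: iota0_cst phi_const taylor_cst)

lemma phi_iota0_add: "\<phi> (\<iota>0 (a + b)) = \<phi> (\<iota>0 a) + \<phi> (\<iota>0 b)"
  by (simp add: iota0_add phi_add galois_hull.iota0)

lemma phi_iota0_mult: "\<phi> (\<iota>0 (a * b)) = \<phi> (\<iota>0 a) * \<phi> (\<iota>0 b)"
  by (simp add: iota0_mult phi_mult galois_hull.iota0)

text \<open>
  The initial value \<open>u\<close> at \<open>n = 0\<close> in degree \<open>0\<close> determines the image of \<open>\<iota>\<^sub>0(t)\<close>: \<open>\<Theta>\<^sup>(\<^sup>1\<^sup>)\<close> maps
  it to \<open>1\<close>, so it is \<open>a\<^sub>0 + X\<close>, and \<open>\<Sigma>\<close> multiplies it by \<open>q\<close>, so \<open>a\<^sub>0 = u Q\<close>.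
\<close>

definition phi_u where "phi_u = tps_nth (\<phi> (\<iota>0 tvar)) 0 0"

lemma phi_iota0_tvar: "\<phi> (\<iota>0 tvar) = tps_fun (\<lambda>n. scalar (q powi n) * phi_u) + tps_X"
proof (rule tps_eqI)
  fix i n
  have *: "scalar (qint q (Suc j)) * tps_nth (\<phi> (\<iota>0 tvar)) (Suc j) n = (if j = 0 then 1 else 0)"
    for j
    using phi_iota0_theta1[of tvar j n] by (simp add: theta1_tvar iota0_1 phi_1)
  have "tps_nth (\<phi> (\<iota>0 tvar)) (Suc j) n = (if j = 0 then 1 else 0)" for j
    using scalar_solve[OF _ *[of j]] by auto
  moreover have "tps_nth (\<phi> (\<iota>0 tvar)) 0 n = scalar (q powi n) * phi_u"
    unfolding phi_u_def
  proof (rule scalar_powi_rec)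
    fix n
    have "hat_Sigma (scalar2 \<eta>) q (\<phi> (\<iota>0 tvar)) = tps_const (scalar q) * \<phi> (\<iota>0 tvar)"
      using phi_iota0_sigma[of tvar]
      by (simp add: sigma_generators q_neq_0 phi_iota0_mult phi_iota0_cst)
    from arg_cong[OF this, of "\<lambda>F. tps_nth F 0 n"]
    show "tps_nth (\<phi> (\<iota>0 tvar)) 0 (n + 1) = scalar q * tps_nth (\<phi> (\<iota>0 tvar)) 0 n"
      by simp
  qed (rule q_neq_0)
  ultimately show "tps_nth (\<phi> (\<iota>0 tvar)) i n =
      tps_nth (tps_fun (\<lambda>n. scalar (q powi n) * phi_u) + tps_X) i n"
    by (cases i) auto
qed

definition phi_e where "phi_e = phi_u $ 0 $ 1"
definition phi_f where "phi_f = phi_u $ 0 $ 0 - phi_e * \<eta> tvar"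

lemma deriv_W_1: "deriv_W1 1 = (0::'a fps2)" "deriv_W2 1 = (0::'a fps2)"
  "deriv_W1 0 = (0::'a fps2)" "deriv_W2 0 = (0::'a fps2)"
  by (auto intro!: fps2_eqI simp: deriv_W1_nth deriv_W2_nth simp del: of_nat_Suc)

lemma deriv_W1_scalar: "deriv_W1 (scalar c * F) = scalar c * deriv_W1 F"
  by (rule fps2_eqI) (simp only: deriv_W1_nth scalar_nth, rule eta_left_commute)

text \<open>
  \<open>Q\<close> is killed by both derivations, so its image \<open>(\<partial>u/\<partial>W\<^sub>1) Q\<close> has a constant coefficient \<open>e\<close>;
  as \<open>\<iota>\<^sub>0(t)\<close> is killed by \<open>\<partial>/\<partial>y\<close>, integration gives \<open>u = e (t + W\<^sub>1) + f\<close>.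
\<close>

lemma phi_Qseries: "\<phi> Qseries = tps_fun (\<lambda>n. scalar (q powi n) * const2 phi_e)"
  and phi_u_eq: "phi_u = lin_W1 \<eta> phi_e phi_f"
proof -
  have Q: "\<phi> Qseries = tps_fun (\<lambda>n. scalar (q powi n) * deriv_W1 phi_u)"
    using phi_deriv_t[OF galois_hull.iota0, of tvar] unfolding deriv_iota0_tvar phi_iota0_tvar
    by (auto intro!: tps_eqI simp: deriv_W_1 deriv_W1_scalar)
  have "map_tps deriv_W1 (\<phi> Qseries) = 0" "map_tps deriv_W2 (\<phi> Qseries) = 0"
    using phi_deriv_t[OF hull_Qseries] phi_deriv_y[OF hull_Qseries]
    by (simp_all add: deriv_Qseries phi_0)
  from this[THEN arg_cong, of "\<lambda>F. tps_nth F 0 0"]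
  have E: "deriv_W1 (deriv_W1 phi_u) = 0" "deriv_W2 (deriv_W1 phi_u) = 0"
    by (simp_all add: Q)
  have "map_tps deriv_W2 (\<phi> (\<iota>0 tvar)) = 0"
    using phi_deriv_y[OF galois_hull.iota0, of tvar] by (simp add: deriv_iota0_tvar phi_0)
  from arg_cong[OF this, of "\<lambda>F. tps_nth F 0 0"] have u2: "deriv_W2 phi_u = 0"
    by (simp add: phi_u_def)
  have du: "deriv_W1 phi_u = const2 phi_e"
  proof (rule fps2_eqI)
    fix m n
    show "deriv_W1 phi_u $ m $ n = const2 phi_e $ m $ n"
      using deriv_W1_eq_0D[OF E(1), of m "n - 1"] deriv_W2_eq_0D[OF E(2), of "m - 1" n]
        deriv_W1_nth[of phi_u 0 0]
      by (cases m; cases n) (simp_all add: const2_nth phi_e_def)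
  qed
  with Q show "\<phi> Qseries = tps_fun (\<lambda>n. scalar (q powi n) * const2 phi_e)" by simp
  show "phi_u = lin_W1 \<eta> phi_e phi_f"
  proof (rule fps2_eqI)
    fix m n
    have "sc (of_nat (Suc (Suc k))) * phi_u $ 0 $ Suc (Suc k) = 0" for k
      using deriv_W1_nth[of phi_u 0 "Suc k"] by (simp add: du const2_nth)
    then have "phi_u $ 0 $ Suc (Suc k) = 0" for k
      using sc_cancel[of "of_nat (Suc (Suc k))"] by (metis of_nat_neq_0)
    then show "phi_u $ m $ n = lin_W1 \<eta> phi_e phi_f $ m $ n"
      using deriv_W2_eq_0D[OF u2, of "m - 1" n]
      by (cases m; cases n; cases "n - 1")
        (simp_all add: lin_W1_nth phi_e_def phi_f_def)
  qed
qed

lemma phi_X: "\<phi> tps_X = tps_fun (\<lambda>n. scalar (q powi n) * const2 phi_f) + tps_X"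
proof -
  have "\<phi> (\<iota>0 tvar) = tps_const (taylor \<eta> tvar) * \<phi> Qseries + \<phi> tps_X"
    by (simp add: iota0_tvar phi_add phi_mult phi_const galois_hull.intros hull_Qseries hull_X)
  then have *: "\<phi> tps_X = \<phi> (\<iota>0 tvar) - tps_const (taylor \<eta> tvar) * \<phi> Qseries"
    by simp
  have "(const2 (\<eta> tvar) + W1) * const2 phi_e = const2 phi_e * (const2 (\<eta> tvar) + W1)"
    by (rule fps2_eqI) (simp add: const2_nth W1_nth eta_central)
  then have "phi_u - taylor \<eta> tvar * const2 phi_e = const2 phi_f"
    by (simp add: phi_u_eq lin_W1_def taylor_tvar)
  then have "scalar c * phi_u - taylor \<eta> tvar * (scalar c * const2 phi_e) = scalar c * const2 phi_f"
    for c
    by (metis right_diff_distrib scalar_left_commute)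
  then show ?thesis unfolding * phi_iota0_tvar phi_Qseries
    by (auto intro!: tps_eqI)
qed

lemma phi_e_nilpotent: "nilpotent (phi_e - 1)"
proof -
  have "tps_nth Qseries 0 0 = 1" by (simp add: Qseries_def)
  then show ?thesis
    using phi_nilpotent[OF hull_Qseries, of 0 0 0 0] taylor_cst[of 1]
    by (simp add: phi_Qseries iota_def const2_nth)
qed

text \<open>\<open>Q\<close> and \<open>X\<close> are mapped to \<open>e Q\<close> and \<open>f Q + X\<close>, and \<open>Q X = q X Q\<close>.\<close>

lemma phi_ef: "phi_e * phi_f = \<eta> (cst q) * phi_f * phi_e"
proof -
  have "\<phi> Qseries * \<phi> tps_X = tps_const (scalar q) * (\<phi> tps_X * \<phi> Qseries)"
    using arg_cong[OF Qseries_X, of \<phi>]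
    by (simp add: phi_mult phi_const taylor_cst galois_hull.intros hull_Qseries hull_X)
  from arg_cong[OF this, of "\<lambda>F. tps_nth F 0 0 $ 0 $ 0"] show ?thesis
    by (simp add: phi_Qseries phi_X const2_nth mult.assoc) (simp add: scalar2_def const2_nth)
qed

text \<open>
  The image of \<open>\<iota>\<^sub>0(t\<^sup>-\<^sup>1)\<close> is inverse to \<open>u Q + X\<close>, so its initial value is inverse to \<open>u\<close>.
\<close>

definition phi_uinv where "phi_uinv = tps_nth (\<phi> (\<iota>0 (inverse tvar))) 0 0"

lemma phi_inverse:
  "a \<noteq> 0 \<Longrightarrow>
     \<phi> (\<iota>0 a) * \<phi> (\<iota>0 (inverse a)) = 1 \<and> \<phi> (\<iota>0 (inverse a)) * \<phi> (\<iota>0 a) = 1"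
  by (simp add: iota0_1 phi_1 flip: phi_iota0_mult)

lemma phi_u_uinv: "phi_u * phi_uinv = 1" and phi_uinv_phi_u: "phi_uinv * phi_u = 1"
  using phi_inverse[OF tvar_neq_0] arg_cong[of _ _ "\<lambda>F. tps_nth F 0 0"]
  unfolding phi_u_def phi_uinv_def by (metis tps_nth_mult_0 tps_nth_simps(4))+

lemma ring_inverse_u: "ring_inverse phi_u = phi_uinv"
  unfolding ring_inverse_def
  by (rule the_equality)
    (use phi_u_uinv phi_uinv_phi_u in \<open>auto, metis mult.assoc mult_1_left mult_1_right\<close>)

text \<open>
  The product with \<open>u Q + X\<close> being \<open>1\<close>, its coefficient of \<open>X\<^sup>k\<^sup>+\<^sup>1\<close> expresses the coefficient \<open>k + 1\<close>
  at \<open>n\<close> through the coefficient \<open>k\<close> at \<open>n + 1\<close>. The exponent \<open>k (k + 1) / 2\<close> of \<open>q\<close> accumulates from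
  these shifts.
\<close>

lemma phi_iota0_inverse_tvar:
  "tps_nth (\<phi> (\<iota>0 (inverse tvar))) k n =
     scalar ((- 1) ^ k / q ^ (k * Suc k div 2) * q powi (- (int (Suc k) * n))) * phi_uinv ^ Suc k"
proof -
  let ?V = "\<phi> (\<iota>0 (inverse tvar))"
  have VT: "?V * \<phi> (\<iota>0 tvar) = 1" using phi_inverse[OF tvar_neq_0] by blast
  have solve: "x = scalar (q powi (- n)) * (y * phi_uinv)"
    if "x * (scalar (q powi n) * phi_u) = y" for x y n
  proof -
    have "y * phi_uinv = scalar (q powi n) * (x * (phi_u * phi_uinv))"
      by (simp add: scalar_left_commute mult.assoc flip: that)
    then have "y * phi_uinv = scalar (q powi n) * x" by (simp add: phi_u_uinv)
    then show ?thesis using q_neq_0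
      by (simp add: scalar_scalar power_int_minus del: scalar_simps(4))
  qed
  show ?thesis
  proof (induction k arbitrary: n)
    case 0
    have "tps_nth ?V 0 n * (scalar (q powi n) * phi_u) = 1"
      using arg_cong[OF VT, of "\<lambda>F. tps_nth F 0 n"] by (simp add: phi_iota0_tvar)
    from solve[OF this] show ?case by simp
  next
    case (Suc k)
    have "tps_nth ?V (Suc k) n * (scalar (q powi n) * phi_u) + tps_nth ?V k (n + 1) = 0"
      using arg_cong[OF VT, of "\<lambda>F. tps_nth F (Suc k) n"]
      by (simp add: phi_iota0_tvar distrib_left)
    then have "tps_nth ?V (Suc k) n * (scalar (q powi n) * phi_u) = - tps_nth ?V k (n + 1)"
      by (simp add: eq_neg_iff_add_eq_0)
    also have "\<dots> = scalar (- 1) * tps_nth ?V k (n + 1)"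
      by (simp only: scalar_minus_1)
    finally have *: "tps_nth ?V (Suc k) n =
        scalar (q powi (- n)) * (scalar (- 1) * tps_nth ?V k (n + 1) * phi_uinv)"
      by (rule solve)
    define c where "c = (- 1) ^ k / q ^ (k * Suc k div 2) * q powi (- (int (Suc k) * (n + 1)))"
    have "q powi (- n) * q powi (- (int (Suc k) * (n + 1))) =
        q powi (- (int (Suc (Suc k)) * n) - int (Suc k))"
      unfolding power_int_add[OF disjI1, OF q_neq_0, symmetric]
      by (rule arg_cong[of _ _ "\<lambda>i. q powi i"]) (simp add: algebra_simps)
    also have "\<dots> = q powi (- (int (Suc (Suc k)) * n)) / q ^ Suc k"
      by (simp only: power_int_diff[OF disjI1, OF q_neq_0] power_int_of_nat)
    finally have shift: "q powi (- n) * q powi (- (int (Suc k) * (n + 1))) =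
        q powi (- (int (Suc (Suc k)) * n)) / q ^ Suc k" .
    have "x * (- 1 * (s / a * z)) = - 1 * s / a * (x * z)" for x s a z :: complex by simp
    then have "q powi (- n) * (- 1 * c) = (- 1) ^ Suc k / q ^ (k * Suc k div 2) *
        (q powi (- (int (Suc (Suc k)) * n)) / q ^ Suc k)"
      unfolding c_def power_Suc[of "- 1"] by (simp only: shift)
    moreover have "Suc k * Suc (Suc k) div 2 = k * Suc k div 2 + Suc k" by simp
    ultimately have "q powi (- n) * (- 1 * c) =
      (- 1) ^ Suc k / q ^ (Suc k * Suc (Suc k) div 2) * q powi (- (int (Suc (Suc k)) * n))"
      by (simp add: power_add)
    moreover have "tps_nth ?V (Suc k) n =
        scalar (q powi (- n) * (- 1 * c)) * phi_uinv ^ Suc (Suc k)"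
      unfolding * Suc.IH c_def[symmetric]
      by (simp only: scalar_simps(4) mult.assoc power_Suc power_commutes)
    ultimately show ?case by simp
  qed
qed

definition phi_b where "phi_b = tps_nth (\<phi> (\<iota>0 yvar)) 0 0 $ 0 - fps_const (\<eta> yvar)"

text \<open>\<open>\<partial>/\<partial>y\<close> maps \<open>\<iota>\<^sub>0(y)\<close> to \<open>1\<close>, so its initial value is \<open>W\<^sub>2\<close> plus a series in \<open>W\<^sub>1\<close>.\<close>

lemma phi_iota0_yvar_0: "tps_nth (\<phi> (\<iota>0 yvar)) 0 0 = const2 (\<eta> yvar) + W2 + fps_const phi_b"
proof (rule fps2_eqI)
  fix m n
  let ?F = "tps_nth (\<phi> (\<iota>0 yvar)) 0 0"
  have "map_tps deriv_W2 (\<phi> (\<iota>0 yvar)) = 1"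
    using phi_deriv_y[OF galois_hull.iota0, of yvar] by (simp add: deriv_y_iota0_yvar phi_1)
  from arg_cong[OF this, of "\<lambda>F. tps_nth F 0 0"]
  have *: "deriv_W2 ?F = 1" by simp
  have 1: "?F $ Suc 0 $ n = (1 :: 'a fps) $ n"
    using arg_cong[OF *, of "\<lambda>F. F $ 0 $ n"] by (simp add: deriv_W2_nth)
  have "sc (of_nat (Suc (Suc k))) * ?F $ Suc (Suc k) $ n = 0" for k
    using deriv_W2_nth[of ?F "Suc k" n] by (simp add: *)
  then have 2: "?F $ Suc (Suc k) $ n = 0" for k
    using sc_cancel[of "of_nat (Suc (Suc k))"] by (metis of_nat_neq_0)
  show "?F $ m $ n = (const2 (\<eta> yvar) + W2 + fps_const phi_b) $ m $ n"
    by (cases m; cases "m - 1") (auto simp: 1 2 const2_nth W2_nth phi_b_def)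
qed

lemma phi_b_nilpotent: "nilpotent (phi_b $ n)"
  using phi_nilpotent[OF galois_hull.iota0, of yvar 0 0 0 n]
  by (simp add: phi_iota0_yvar_0 iota_def taylor_yvar)

text \<open>\<open>t y = y t\<close>, read off at the initial values.\<close>

lemma phi_u_b:
  "lin_W1 \<eta> phi_e phi_f * (W2 + fps_const phi_b) =
    (W2 + fps_const phi_b) * lin_W1 \<eta> phi_e phi_f"
proof -
  have "\<phi> (\<iota>0 tvar) * \<phi> (\<iota>0 yvar) = \<phi> (\<iota>0 yvar) * \<phi> (\<iota>0 tvar)"
    by (simp add: mult.commute flip: phi_iota0_mult)
  from arg_cong[OF this, of "\<lambda>F. tps_nth F 0 0"]
  have "phi_u * (const2 (\<eta> yvar) + W2 + fps_const phi_b) =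
      (const2 (\<eta> yvar) + W2 + fps_const phi_b) * phi_u"
    by (simp add: phi_iota0_tvar phi_iota0_yvar_0)
  moreover have "phi_u * const2 (\<eta> yvar) = const2 (\<eta> yvar) * phi_u"
    by (rule fps2_eqI) (simp add: eta_central)
  ultimately show ?thesis by (simp add: algebra_simps phi_u_eq)
qed

text \<open>
  In degree \<open>0\<close> the values come from \<open>\<sigma>(y) = y + log q\<close>; in positive degree they come from
  \<open>\<theta>\<^sup>(\<^sup>1\<^sup>)(y) = log q / ((q - 1) t)\<close> and the image of \<open>\<iota>\<^sub>0(t\<^sup>-\<^sup>1)\<close>.
\<close>

lemma phi_iota0_yvar: "\<phi> (\<iota>0 yvar) = image_y q lq \<eta> phi_e phi_f phi_b"
proof (rule tps_eqI)
  fix i n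
  let ?Y = "\<phi> (\<iota>0 yvar)"
  show "tps_nth ?Y i n = tps_nth (image_y q lq \<eta> phi_e phi_f phi_b) i n"
  proof (cases i)
    case 0
    have "hat_Sigma (scalar2 \<eta>) q ?Y = ?Y + tps_const (scalar lq)"
      using phi_iota0_sigma[of yvar]
      by (simp add: sigma_generators q_neq_0 phi_iota0_add phi_iota0_cst)
    from arg_cong[OF this, of "\<lambda>F. tps_nth F 0 _"]
    have rec: "tps_nth ?Y 0 (n + 1) = tps_nth ?Y 0 n + scalar lq" for n
      by simp
    have "tps_nth ?Y 0 n = tps_nth ?Y 0 0 + scalar (lq * of_int n)"
    proof (induction n rule: int_induct[where k = 0])
      case (step1 i)
      then show ?case by (simp add: rec distrib_left add.assoc del: scalar_simps(4))
    next
      case (step2 i)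
      have "tps_nth ?Y 0 (i - 1) + scalar lq = tps_nth ?Y 0 0 + scalar (lq * of_int (i - 1) + lq)"
        using rec[of "i - 1"] step2 by (simp add: algebra_simps del: scalar_simps)
      then show ?case unfolding scalar_simps(3)
        by (simp add: add.assoc[symmetric] del: scalar_simps)
    qed simp
    then show ?thesis
      by (simp add: 0 phi_iota0_yvar_0 image_y_def)
  next
    case (Suc k)
    define V where "V = tps_nth (\<phi> (\<iota>0 (inverse tvar))) k n"
    define c where "c = (- 1) ^ k / q ^ (k * Suc k div 2) * q powi (- (int (Suc k) * n))"
    define d where "d = lq / (q - 1) * (- 1) ^ (i + 1) / (qint q i * q ^ (i * (i - 1) div 2))"
    have V: "V = scalar c * phi_uinv ^ i"
      by (simp add: V_def c_def phi_iota0_inverse_tvar Suc)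
    have "scalar (qint q i) * tps_nth ?Y i n = scalar (lq / (q - 1)) * V"
      using phi_iota0_theta1[of yvar k n]
      by (simp add: Suc theta1_yvar phi_iota0_mult phi_iota0_cst V_def)
    then have "tps_nth ?Y i n = scalar (1 / qint q i) * (scalar (lq / (q - 1)) * V)"
      by (rule scalar_solve[rotated]) (simp add: Suc)
    also have "\<dots> = scalar (1 / qint q i * (lq / (q - 1) * c)) * phi_uinv ^ i"
      by (simp only: V scalar_scalar)
    also have "1 / qint q i * (lq / (q - 1) * c) = d * q powi (- (int i * n))"
    proof -
      have "1 / x * (l / y * (s / a * z)) = l / y * s / (x * a) * z" for x l y s a z :: complex
        by (simp add: ac_simps)
      moreover have "(- 1) ^ (i + 1) = (- 1 :: complex) ^ k" "i * (i - 1) = k * Suc k"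
        by (simp_all add: Suc)
      ultimately show ?thesis unfolding c_def d_def Suc by simp
    qed
    also have "scalar (d * q powi (- (int i * n))) * phi_uinv ^ i =
        scalar d * phi_uinv ^ i * scalar (q powi (- (int i * n)))"
      by (simp only: scalar_simps(4) mult.assoc scalar_central[of "phi_uinv ^ i"])
    finally show ?thesis
      by (simp add: image_y_def Suc d_def ring_inverse_u flip: phi_u_eq)
  qed
qed

lemma has_params: "has_params q lq \<eta> \<phi> (phi_e, phi_f, phi_b)"
proof -
  have "\<phi> (\<iota>0 tvar) = image_t q \<eta> phi_e phi_f"
    by (auto intro!: tps_eqI simp: phi_iota0_tvar image_t_def scalar_central[of phi_u]
        simp flip: phi_u_eq)
  then show ?thesis by (simp add: has_params_def phi_iota0_yvar)
qed

lemma has_params_unique: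
  assumes "has_params q lq \<eta> \<phi> p"
  shows "p = (phi_e, phi_f, phi_b)"
proof -
  obtain e' f' b' where p: "p = (e', f', b')" by (cases p) auto
  have 1: "\<phi> (\<iota>0 tvar) = image_t q \<eta> e' f'" and 2: "\<phi> (\<iota>0 yvar) = image_y q lq \<eta> e' f' b'"
    using assms by (simp_all add: has_params_def p)
  have u: "phi_u = lin_W1 \<eta> e' f'" by (simp add: phi_u_def 1 image_t_def)
  then have e: "phi_e = e'" by (simp add: phi_e_def lin_W1_nth)
  moreover have "phi_f = f'" by (simp add: phi_f_def e) (simp add: u lin_W1_nth)
  moreover have "phi_b = b'"
    by (auto simp: phi_b_def 2 image_y_def W2_nth const2_nth fps_eq_iff)
  ultimately show ?thesis by (simp add: p)
qed

lemma the_params_eq: "the_params q lq \<eta> \<phi> = (phi_e, phi_f, phi_b)"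
  unfolding the_params_def using has_params has_params_unique by (rule the_equality)

end

end

section \<open>Deformations are determined by their parameters\<close>

context nc_alg
begin

text \<open>
  The hull is generated by \<open>\<iota>\<^sub>0(L)\<close> and the constants under operations that deformations
  respect, and \<open>\<iota>\<^sub>0(L)\<close> is generated by \<open>\<iota>\<^sub>0(t)\<close> and \<open>\<iota>\<^sub>0(y)\<close> as a field. Inverses are unique also
  in a noncommutative ring.
\<close>

lemma NCF_eqI:
  assumes \<phi>: "\<phi> \<in> NCF q lq \<eta>" and \<psi>: "\<psi> \<in> NCF q lq \<eta>"
    and t: "\<phi> (\<iota>0 tvar) = \<psi> (\<iota>0 tvar)" and y: "\<phi> (\<iota>0 yvar) = \<psi> (\<iota>0 yvar)"
  shows "\<phi> = \<psi>"
proof -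
  have field: "\<phi> (\<iota>0 a) = \<psi> (\<iota>0 a)" for a
  proof (induction a rule: ratfun_induct)
    case (inverse a)
    have "\<phi> (\<iota>0 (inverse a)) = \<phi> (\<iota>0 (inverse a)) * (\<phi> (\<iota>0 a) * \<psi> (\<iota>0 (inverse a)))"
      using phi_inverse[OF \<psi> inverse(2)] inverse(1) by simp
    also have "\<dots> = \<psi> (\<iota>0 (inverse a))"
      using phi_inverse[OF \<phi> inverse(2)] by (simp flip: mult.assoc)
    finally show ?case .
  qed (simp_all add: t y phi_iota0_cst phi_iota0_add phi_iota0_mult \<phi> \<psi>)
  have "\<phi> F = \<psi> F" if "F \<in> \<G>" for F
    using that
    by induction (simp_all add: field phi_const[OF \<phi>] phi_const[OF \<psi>]
      phi_add[OF \<phi>] phi_add[OF \<psi>] phi_mult[OF \<phi>] phi_mult[OF \<psi>] phi_Sigma[OF \<phi>] phi_Sigma[OF \<psi>]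
      phi_Theta[OF \<phi>] phi_Theta[OF \<psi>] phi_deriv_t[OF \<phi>] phi_deriv_t[OF \<psi>]
      phi_deriv_y[OF \<phi>] phi_deriv_y[OF \<psi>])
  moreover have "\<phi> \<in> extensional \<G>" "\<psi> \<in> extensional \<G>"
    using \<phi> \<psi> unfolding NCF_def by blast+
  ultimately show ?thesis by (metis extensionalityI)
qed

end

section \<open>Nilpotent elements of a noncommutative ring\<close>

lemma commute_mult:
  fixes a x y :: "'a::semigroup_mult"
  assumes "a * x = x * a" "a * y = y * a"
  shows "a * (x * y) = x * y * a"
  by (metis assms mult.assoc)

lemma commute_add:
  fixes a x y :: "'a::ring"
  assumes "a * x = x * a" "a * y = y * a"
  shows "a * (x + y) = (x + y) * a"
  by (simp add: assms distrib_left distrib_right)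

lemma commute_power:
  fixes a x :: "'a::monoid_mult"
  assumes "a * x = x * a"
  shows "a * x ^ n = x ^ n * a"
  using assms by (metis power_commuting_commutes)

lemma commute_sum:
  fixes x :: "'a::ring"
  assumes "\<And>i. i \<in> I \<Longrightarrow> x * F i = F i * x"
  shows "x * (\<Sum>i\<in>I. F i) = (\<Sum>i\<in>I. F i) * x"
  unfolding sum_distrib_left sum_distrib_right by (rule sum.cong) (simp_all add: assms)

lemma commuting_power_mult:
  fixes x y :: "'a::monoid_mult"
  assumes "x * y = y * x"
  shows "(x * y) ^ n = x ^ n * y ^ n"
proof (induction n)
  case (Suc n)
  have "(x * y) ^ Suc n = x * (y * x ^ n) * y ^ n"
    by (simp only: power_Suc Suc mult.assoc)
  also have "y * x ^ n = x ^ n * y"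
    using assms by (intro commute_power) simp
  finally show ?case by (simp only: power_Suc mult.assoc)
qed simp

lemma nilpotent_0 [simp]: "nilpotent (0 :: 'a::{ring, monoid_mult})"
  unfolding nilpotent_def by (rule exI[of _ 1]) simp

lemma nilpotent_mult:
  fixes x y :: "'a::{ring, monoid_mult}"
  assumes "nilpotent x" "x * y = y * x"
  shows "nilpotent (x * y)"
  using assms unfolding nilpotent_def by (metis commuting_power_mult mult_zero_left)

text \<open>
  Modulo \<open>d\<close>, which commutes with \<open>x\<close> and \<open>y\<close>, the \<open>k\<close>-th power of \<open>x + d y\<close> is \<open>x\<^sup>k\<close>. Once
  \<open>x\<^sup>k = 0\<close>, that power is \<open>d z\<close> with \<open>z\<close> commuting with \<open>d\<close>. The elements \<open>x\<close> and \<open>y\<close>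
  may fail to commute with each other.
\<close>

lemma nilpotent_add_mult:
  fixes x d y :: "'a::{ring, monoid_mult}"
  assumes "nilpotent x" "nilpotent d" and dx: "d * x = x * d" and dy: "d * y = y * d"
  shows "nilpotent (x + d * y)"
proof -
  have expand: "\<exists>z. (x + d * y) ^ k = x ^ k + d * z \<and> d * z = z * d" for k
  proof (induction k)
    case 0
    then show ?case by (intro exI[of _ 0]) simp
  next
    case (Suc k)
    then obtain z where z: "(x + d * y) ^ k = x ^ k + d * z" "d * z = z * d" by blast
    let ?z = "x * z + y * x ^ k + y * d * z"
    have "(x + d * y) ^ Suc k = x ^ Suc k + d * ?z"
    proof -
      have "x * (d * z) = d * (x * z)" by (simp only: dx flip: mult.assoc)
      then show ?thesis by (simp add: z(1) distrib_left distrib_right mult.assoc)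
    qed
    moreover have "d * ?z = ?z * d"
      by (intro commute_add commute_mult commute_power z(2) dx dy refl)
    ultimately show ?case by blast
  qed
  obtain k l where k: "x ^ k = 0" and l: "d ^ l = 0"
    using assms unfolding nilpotent_def by blast
  obtain z where "(x + d * y) ^ k = d * z" "d * z = z * d"
    using expand[of k] k by auto
  then have "(x + d * y) ^ (k * l) = 0"
    using l by (simp add: power_mult commuting_power_mult)
  then show ?thesis unfolding nilpotent_def by blast
qed

lemma nilpotent_add:
  fixes x y :: "'a::{ring, monoid_mult}"
  assumes "nilpotent x" "nilpotent y" "x * y = y * x"
  shows "nilpotent (x + y)"
  using nilpotent_add_mult[of x y 1] assms by simp

section \<open>The quantum formal groups\<close>

context nc_alg
begin

text \<open>
  With \<open>d = e - 1\<close> the relation \<open>e f = q f e\<close> reads \<open>d f = f w\<close> for \<open>w = q d + (q - 1)\<close>, so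
  \<open>d\<^sup>N f = f w\<^sup>N\<close>. The left-hand side vanishes for large \<open>N\<close>, while \<open>w\<close> is the nonzero constant
  \<open>q - 1\<close> up to a nilpotent and can be cancelled. Hence \<open>f = 0\<close> for every pair in either of the
  quantum formal groups.
\<close>

lemma skew_nilpotent_eq_0:
  assumes e: "nilpotent (e - 1)" and ef: "e * f = sc q * f * e"
  shows "f = (0 :: 'a)"
proof -
  define d where "d = e - 1"
  define w where "w = sc q * d + sc (q - 1)"
  have e_eq: "e = d + 1" by (simp add: d_def)
  obtain N where N: "d ^ N = 0" using e unfolding nilpotent_def d_def by blast
  have "sc (q - 1) + 1 = sc q"
    unfolding eta_simps(1,2)[symmetric] by simp
  then have sc: "sc q = sc (q - 1) + 1" by simp
  have "d * f = f * w"
  proof -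
    have "d * f + f = sc q * (f * d) + sc q * f"
      using ef unfolding e_eq by (simp add: distrib_left distrib_right mult.assoc)
    also have "sc q * f = f * sc (q - 1) + f"
      unfolding sc by (simp add: distrib_right eta_central[of f] del: cst_simps(6))
    finally have "d * f = sc q * (f * d) + f * sc (q - 1)" by simp
    then show ?thesis unfolding w_def distrib_left by (simp only: eta_left_commute)
  qed
  then have "d ^ k * f = f * w ^ k" for k
  proof (induction k)
    case (Suc k)
    have "d ^ Suc k * f = d ^ k * (d * f)" by (simp only: power_Suc2 mult.assoc)
    also have "\<dots> = d ^ k * f * w" by (simp only: Suc.prems mult.assoc)
    also have "\<dots> = f * w ^ Suc k" by (simp only: Suc.IH[OF Suc.prems] power_Suc2 mult.assoc)
    finally show ?case .
  qed simp
  then have "f * w ^ N = 0" using N by (metis mult_zero_left)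
  moreover have cancel: "x = 0" if "x * w = 0" for x
  proof -
    define c where "c = - q / (q - 1)"
    have "sc q * (x * d) + sc (q - 1) * x = 0"
      using that unfolding w_def distrib_left by (simp only: eta_left_commute eta_central[of x])
    then have "sc (- 1 / (q - 1)) * (sc q * (x * d) + sc (q - 1) * x) = 0" by simp
    then have "sc (- 1 / (q - 1) * q) * (x * d) + sc (- 1 / (q - 1) * (q - 1)) * x = 0"
      by (simp only: distrib_left eta_simps cst_simps(4) mult.assoc)
    moreover have "- 1 / (q - 1) * q = c" "- 1 / (q - 1) * (q - 1) = - 1"
      using q_neq_1 by (simp_all add: c_def divide_simps)
    ultimately have "sc c * (x * d) + sc (- 1) * x = 0" by (simp only:)
    then have x: "x = sc c * (x * d)" by (simp add: eta_uminus)
    have "x = sc (c ^ k) * (x * d ^ k)" for k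
    proof (induction k)
      case (Suc k)
      have "x = sc (c ^ k) * ((sc c * (x * d)) * d ^ k)"
        by (simp only: x[symmetric] Suc[symmetric])
      then show ?case
        by (simp only: mult.assoc power_Suc2[of c] power_Suc[of d] eta_simps
            cst_simps(4))
    qed simp
    from this[of N] show "x = 0" by (simp add: N)
  qed
  have "x = 0" if "x * w ^ k = 0" for x k
    using that
  proof (induction k)
    case (Suc k)
    then show ?case using cancel[of "x * w ^ k"] by (simp only: power_Suc2 mult.assoc)
  qed simp
  ultimately show "f = 0" by blast
qed

text \<open>
  \<open>lin_W1\<close> regarded as a series in \<open>W\<^sub>1\<close> alone. \<open>W\<^sub>2\<close> is central, so both groups require the same:
  that this series commutes with \<open>b\<close>.
\<close>

definition affine :: "'a \<Rightarrow> 'a \<Rightarrow> 'a fps"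
  where "affine e f = fps_const e * (fps_const (\<eta> tvar) + fps_X) + fps_const f"

lemma lin_W1_affine: "lin_W1 \<eta> e f = fps_const (affine e f)"
  by (simp add: lin_W1_def affine_def const2_def W1_def)

lemma trans_pair_eq:
  "trans_pair \<eta> e f b = (lin_W1 \<eta> e f - const2 (\<eta> tvar), W2 + fps_const b)"
  by (auto simp: trans_pair_def lin_W1_nth const2_nth W1_nth algebra_simps intro!: fps2_eqI)

lemma lin_W1_commute_iff:
  "lin_W1 \<eta> e f * (W2 + fps_const b) = (W2 + fps_const b) * lin_W1 \<eta> e f \<longleftrightarrow>
     affine e f * b = b * affine e f"
proof -
  have "lin_W1 \<eta> e f * (W2 + fps_const b) = (W2 + fps_const b) * lin_W1 \<eta> e f \<longleftrightarrow>
      fps_const (affine e f * b) = fps_const (b * affine e f)"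
    unfolding lin_W1_affine W2_def distrib_left distrib_right
    by (simp add: fps_mult_fps_X_commute)
  then show ?thesis by simp
qed

lemma trans_pair_commute_iff:
  "fst (trans_pair \<eta> e f b) * snd (trans_pair \<eta> e f b) =
     snd (trans_pair \<eta> e f b) * fst (trans_pair \<eta> e f b) \<longleftrightarrow>
   affine e f * b = b * affine e f"
proof -
  have "const2 (\<eta> tvar) * F = F * const2 (\<eta> tvar)" for F
    by (rule fps2_eqI) (simp add: eta_central[symmetric])
  moreover have "(l - c) * w = w * (l - c) \<longleftrightarrow> l * w = w * l" if "c * w = w * c"
    for l c w :: "'a fps2"
    using that by (simp add: left_diff_distrib right_diff_distrib)
  ultimately show ?thesis unfolding lin_W1_commute_iff[symmetric] trans_pair_eq fst_conv snd_conv
    by blast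
qed

text \<open>
  The coefficient of \<open>W\<^sub>1\<^sup>n\<close> in the commutator is \<open>t [e, b\<^sub>n] + [e, b\<^bsub>n-1\<^esub>]\<close>, and \<open>t\<close> is invertible.
\<close>

lemma affine_commute_iff: "affine e 0 * b = b * affine e 0 \<longleftrightarrow> (\<forall>n. e * b $ n = b $ n * e)"
proof -
  have affine: "affine e 0 = fps_const (\<eta> tvar * e) + fps_const e * fps_X"
    by (simp add: affine_def distrib_left eta_central[of e])
  have l: "(affine e 0 * b) $ n = \<eta> tvar * (e * b $ n) + (if n = 0 then 0 else e * b $ (n - 1))" for n
    unfolding affine distrib_right by (simp add: mult.assoc)
  have r: "(b * affine e 0) $ n = \<eta> tvar * (b $ n * e) + (if n = 0 then 0 else b $ (n - 1) * e)" for n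
  proof -
    have "(b * (fps_const e * fps_X)) $ n = (if n = 0 then 0 else b $ (n - 1) * e)"
      by (simp flip: mult.assoc)
    then show ?thesis unfolding affine distrib_left by (simp add: eta_left_commute)
  qed
  show ?thesis
  proof
    assume "\<forall>n. e * b $ n = b $ n * e"
    then show "affine e 0 * b = b * affine e 0" by (simp add: fps_eq_iff l r)
  next
    assume *: "affine e 0 * b = b * affine e 0"
    have "e * b $ n = b $ n * e" for n
    proof (induction n)
      case 0
      have "\<eta> tvar * (e * b $ 0) = \<eta> tvar * (b $ 0 * e)"
        using l[of 0] r[of 0] * by simp
      then show ?case using eta_inverse_cancel[OF tvar_neq_0] by metis
    next
      case (Suc n)
      have "\<eta> tvar * (e * b $ Suc n) = \<eta> tvar * (b $ Suc n * e)"
        using l[of "Suc n"] r[of "Suc n"] * Suc by simp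
      then show ?case using eta_inverse_cancel[OF tvar_neq_0] by metis
    qed
    then show "\<forall>n. e * b $ n = b $ n * e" ..
  qed
qed

text \<open>
  What both groups of pairs come down to after \<open>f = 0\<close>. The coefficients of \<open>b\<close> need not commute
  with each other.
\<close>

definition admissible :: "'a \<Rightarrow> 'a fps \<Rightarrow> bool" where
  "admissible e b \<longleftrightarrow> nilpotent (e - 1) \<and> (\<forall>n. nilpotent (b $ n)) \<and> (\<forall>n. e * b $ n = b $ n * e)"

lemma admissible_iff:
  "e * f = sc q * f * e \<and> affine e f * b = b * affine e f \<and>
     nilpotent (e - 1) \<and> nilpotent f \<and> (\<forall>n. nilpotent (b $ n)) \<longleftrightarrow> f = 0 \<and> admissible e b"
proof -
  have "nilpotent (e - 1) \<Longrightarrow> e * f = sc q * f * e \<Longrightarrow> f = 0"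
    by (rule skew_nilpotent_eq_0)
  then show ?thesis unfolding admissible_def using affine_commute_iff[of e b] by auto
qed

lemma QG3_eq: "QG3 q \<eta> = {(((e, 0), (0, 1)), b) | e b. admissible e b}"
  unfolding QG3_def affine_def[symmetric] admissible_iff by blast

lemma QGIII_eq: "QGIII q \<eta> = {trans_pair \<eta> e 0 b | e b. admissible e b}"
proof -
  have "nilpotent (e - 1) \<and> nilpotent f \<and> (\<forall>n. nilpotent (b $ n)) \<and> e * f = sc q * f * e \<and>
      affine e f * b = b * affine e f \<longleftrightarrow> f = 0 \<and> admissible e b" for e f b
    using admissible_iff[of e f b] by blast
  then show ?thesis unfolding QGIII_def trans_pair_commute_iff by auto
qed

lemma admissible_params:
  assumes "\<phi> \<in> NCF q lq \<eta>"
  shows "phi_f \<phi> = 0" "admissible (phi_e \<phi>) (phi_b \<phi>)"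
proof -
  show f: "phi_f \<phi> = 0"
    using skew_nilpotent_eq_0 phi_e_nilpotent phi_ef assms by blast
  have "affine (phi_e \<phi>) (phi_f \<phi>) * phi_b \<phi> = phi_b \<phi> * affine (phi_e \<phi>) (phi_f \<phi>)"
    using phi_u_b[OF assms] unfolding lin_W1_commute_iff .
  then show "admissible (phi_e \<phi>) (phi_b \<phi>)"
    using phi_e_nilpotent phi_b_nilpotent assms by (simp add: admissible_def f affine_commute_iff)
qed

lemma to_QGIII_eq: "\<phi> \<in> NCF q lq \<eta> \<Longrightarrow> to_QGIII q lq \<eta> \<phi> = trans_pair \<eta> (phi_e \<phi>) 0 (phi_b \<phi>)"
  and to_QG3_eq: "\<phi> \<in> NCF q lq \<eta> \<Longrightarrow> to_QG3 q lq \<eta> \<phi> = (((phi_e \<phi>, 0), (0, 1)), phi_b \<phi>)"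
  by (simp_all add: to_QGIII_def to_QG3_def the_params_eq admissible_params)

lemma to_QGIII_in: "\<phi> \<in> NCF q lq \<eta> \<Longrightarrow> to_QGIII q lq \<eta> \<phi> \<in> QGIII q \<eta>"
  using admissible_params unfolding to_QGIII_eq QGIII_eq by blast

lemma trans_pair_inject: "trans_pair \<eta> e f b = trans_pair \<eta> e' f' b' \<longleftrightarrow> e = e' \<and> f = f' \<and> b = b'"
  by (metis par_trans_pair)

lemma inj_to_QGIII: "inj_on (to_QGIII q lq \<eta>) (NCF q lq \<eta>)"
proof (rule inj_onI)
  fix \<phi> \<psi>
  assume \<phi>: "\<phi> \<in> NCF q lq \<eta>" and \<psi>: "\<psi> \<in> NCF q lq \<eta>" and "to_QGIII q lq \<eta> \<phi> = to_QGIII q lq \<eta> \<psi>"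
  then have "(phi_e \<phi>, phi_f \<phi>, phi_b \<phi>) = (phi_e \<psi>, phi_f \<psi>, phi_b \<psi>)"
    by (simp add: to_QGIII_eq trans_pair_inject admissible_params)
  then have "has_params q lq \<eta> \<phi> (phi_e \<psi>, phi_f \<psi>, phi_b \<psi>)" using has_params[OF \<phi>] by simp
  with has_params[OF \<psi>] show "\<phi> = \<psi>"
    by (intro NCF_eqI[OF \<phi> \<psi>]) (simp_all add: has_params_def)
qed

lemma bij_to_QGIII:
  assumes "bij_betw (to_QG3 q lq \<eta>) (NCF q lq \<eta>) (QG3 q \<eta>)"
  shows "bij_betw (to_QGIII q lq \<eta>) (NCF q lq \<eta>) (QGIII q \<eta>)"
  unfolding bij_betw_def
proof (intro conjI inj_to_QGIII equalityI subsetI)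
  fix v assume "v \<in> to_QGIII q lq \<eta> ` NCF q lq \<eta>"
  then show "v \<in> QGIII q \<eta>" by (auto intro: to_QGIII_in)
next
  fix v assume "v \<in> QGIII q \<eta>"
  then obtain e' b' where v: "v = trans_pair \<eta> e' 0 b'" "admissible e' b'"
    unfolding QGIII_eq by blast
  then have "(((e', 0), (0, 1)), b') \<in> QG3 q \<eta>" unfolding QG3_eq by blast
  then have "(((e', 0), (0, 1)), b') \<in> to_QG3 q lq \<eta> ` NCF q lq \<eta>"
    using assms by (simp add: bij_betw_def)
  then obtain \<phi> where \<phi>: "\<phi> \<in> NCF q lq \<eta>" "to_QG3 q lq \<eta> \<phi> = (((e', 0), (0, 1)), b')"
    by (metis imageE)
  then have "to_QGIII q lq \<eta> \<phi> = v" by (simp add: v to_QG3_eq to_QGIII_eq)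
  then show "v \<in> to_QGIII q lq \<eta> ` NCF q lq \<eta>" using \<phi> by blast
qed

end

section \<open>Substitution of linear series\<close>

context nc_alg
begin

definition linear_series :: "'a \<Rightarrow> 'a \<Rightarrow> 'a fps"
  where "linear_series a g = fps_const a + fps_const g * fps_X"

lemma linear_power_Suc_nth:
  "(linear_series a g ^ Suc n) $ m =
     a * (linear_series a g ^ n) $ m + g * (if m = 0 then 0 else (linear_series a g ^ n) $ (m - 1))"
  by (simp add: linear_series_def distrib_right mult.assoc)

lemma linear_power_nth:
  assumes "a * g = g * a"
  shows "(linear_series a g ^ n) $ m = sc (of_nat (n choose m)) * (a ^ (n - m) * g ^ m)"
proof (induction n arbitrary: m)
  case 0
  then show ?case by (cases m) simp_all
next
  case (Suc n)
  show ?case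
  proof (cases m)
    case 0
    then show ?thesis by (simp only: linear_power_Suc_nth Suc) simp
  next
    case [simp]: (Suc k)
    have "a * (sc (of_nat (n choose Suc k)) * (a ^ (n - Suc k) * g ^ Suc k)) =
        sc (of_nat (n choose Suc k)) * (a ^ (n - k) * g ^ Suc k)"
    proof (cases "k < n")
      case True
      then have "n - k = Suc (n - Suc k)" by simp
      then show ?thesis by (simp only: eta_left_commute power_Suc mult.assoc)
    next
      case False
      then show ?thesis by (simp add: binomial_eq_0)
    qed
    moreover have "g * a ^ (n - k) = a ^ (n - k) * g"
      by (rule commute_power) (rule assms[symmetric])
    then have "g * (a ^ (n - k) * g ^ k) = a ^ (n - k) * g ^ Suc k"
      by (simp only: power_Suc mult.assoc[symmetric])
    then have "g * (sc (of_nat (n choose k)) * (a ^ (n - k) * g ^ k)) =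
        sc (of_nat (n choose k)) * (a ^ (n - k) * g ^ Suc k)"
      by (simp only: eta_left_commute)
    moreover have "of_nat (Suc n choose Suc k) =
        (of_nat (n choose Suc k) + of_nat (n choose k) :: complex)"
      by simp
    ultimately show ?thesis
      unfolding linear_power_Suc_nth Suc.IH Suc
      by (simp only: nat.distinct if_False diff_Suc_1 diff_Suc_Suc cst_simps eta_simps distrib_right)
  qed
qed

lemma linear_power_nth_eq_0:
  assumes "a * g = g * a" "a ^ N = 0" "n < m \<or> m + N \<le> n"
  shows "(linear_series a g ^ n) $ m = 0"
proof (cases "n < m")
  case True
  then show ?thesis using assms(1) by (simp add: linear_power_nth binomial_eq_0)
next
  case False
  then have "n - m = N + (n - m - N)" using assms(3) by simp
  then have "a ^ (n - m) = 0" using assms(2) by (metis mult_zero_left power_add)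
  then show ?thesis using assms(1) by (simp add: linear_power_nth)
qed

text \<open>
  A nilpotent constant term makes the substitution a finite sum, with a bound on the range that
  does not depend on the series into which one substitutes.
\<close>

lemma fps_subst_linear_nth:
  assumes "a * g = g * a" "a ^ N = 0" "m + N \<le> M"
  shows "fps_subst b (linear_series a g) $ m = (\<Sum>n<M. b $ n * (linear_series a g ^ n) $ m)"
proof -
  have "(linear_series a g ^ n) $ m = 0" if "M \<le> n" for n
    using assms that by (intro linear_power_nth_eq_0[of a g N]) auto
  then have "{n. b $ n * (linear_series a g ^ n) $ m \<noteq> 0} \<subseteq> {..<M}"
    by (auto simp: not_less[symmetric]) (metis leI mult_zero_right)
  then show ?thesis unfolding fps_subst_def fps_nth_Abs_fps
    by (intro sum.mono_neutral_left) auto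
qed

lemma commute_linear_power:
  assumes "x * a = a * x" "x * g = g * x"
  shows "x * (linear_series a g ^ n) $ m = (linear_series a g ^ n) $ m * x"
proof (induction n arbitrary: m)
  case (Suc n)
  show ?case unfolding linear_power_Suc_nth
    by (intro commute_add commute_mult assms Suc) (simp add: Suc)
qed simp

text \<open>
  By induction on \<open>n\<close> from \<open>s\<^bsup>n+1\<^esup> = (a + g W\<^sub>1) s\<^sup>n\<close>: this is the composition of two linear series,
  written on the coefficients of their powers. As the coefficients of the series \<open>b\<close> into which one
  substitutes do not occur, associativity of substitution requires no commutation with them.
\<close>

lemma linear_compose:
  assumes ag: "a * g = g * a" and nil: "a ^ N = 0"
    and comm: "a' * a = a * a'" "a' * g = g * a'" "g' * a = a * g'" "g' * g = g * g'"
  shows "(\<Sum>k\<le>n. (linear_series a g ^ n) $ k * (linear_series a' g' ^ k) $ m) =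
    (linear_series (a + g * a') (g * g') ^ n) $ m"
proof (induction n arbitrary: m)
  case (Suc n)
  define p where "p = (\<lambda>k. (linear_series a g ^ n) $ k)"
  define p' where "p' = (\<lambda>k m. (linear_series a' g' ^ k) $ m)"
  define p'' where "p'' m = (\<Sum>k\<le>n. p k * p' k m)" for m
  have p_Suc: "(linear_series a g ^ Suc n) $ k = a * p k + g * (if k = 0 then 0 else p (k - 1))" for k
    unfolding p_def by (rule linear_power_Suc_nth)
  have p'_Suc: "p' (Suc k) m = a' * p' k m + g' * (if m = 0 then 0 else p' k (m - 1))" for k m
    unfolding p'_def by (rule linear_power_Suc_nth)
  have 0: "p (Suc n) = 0" unfolding p_def using ag nil by (intro linear_power_nth_eq_0) auto
  have a': "p k * a' = a' * p k" and g': "p k * g' = g' * p k" for k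
    unfolding p_def by (intro commute_linear_power[symmetric] comm)+
  have "(\<Sum>k\<le>Suc n. (linear_series a g ^ Suc n) $ k * p' k m) =
      (\<Sum>k\<le>Suc n. a * (p k * p' k m)) + (\<Sum>k\<le>Suc n. g * ((if k = 0 then 0 else p (k - 1)) * p' k m))"
    unfolding p_Suc by (simp only: distrib_right mult.assoc sum.distrib)
  also have "(\<Sum>k\<le>Suc n. a * (p k * p' k m)) = a * p'' m"
    by (simp add: 0 p''_def sum_distrib_left)
  also have "(\<Sum>k\<le>Suc n. g * ((if k = 0 then 0 else p (k - 1)) * p' k m)) =
      (\<Sum>k\<le>n. g * (p k * p' (Suc k) m))"
    unfolding sum.atMost_Suc_shift by simp
  also have "\<dots> = (\<Sum>k\<le>n. g * (a' * (p k * p' k m)) +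
      g * (g' * (p k * (if m = 0 then 0 else p' k (m - 1)))))"
  proof -
    have "p k * p' (Suc k) m =
        a' * (p k * p' k m) + g' * (p k * (if m = 0 then 0 else p' k (m - 1)))"
      for k
      unfolding p'_Suc distrib_left by (simp only: a' g' mult.assoc[symmetric])
    then show ?thesis by (simp only: distrib_left)
  qed
  also have "\<dots> = g * a' * p'' m + g * g' * (if m = 0 then 0 else p'' (m - 1))"
    by (simp add: sum.distrib p''_def sum_distrib_left mult.assoc)
  finally have "(\<Sum>k\<le>Suc n. (linear_series a g ^ Suc n) $ k * p' k m) =
      (a + g * a') * p'' m + g * g' * (if m = 0 then 0 else p'' (m - 1))"
    by (simp only: distrib_right add.assoc)
  moreover have "p'' m = (linear_series (a + g * a') (g * g') ^ n) $ m" for m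
    unfolding p''_def p_def p'_def by (rule Suc)
  ultimately show ?case
    unfolding linear_power_Suc_nth[of "a + g * a'"] p'_def by simp
qed simp

section \<open>The product of the quantum formal group\<close>

text \<open>
  The substitution \<open>W\<^sub>1 \<mapsto> (g - 1) t + g W\<^sub>1\<close> is the multiplication of \<open>t + W\<^sub>1\<close> by \<open>g\<close>. Therefore
  two such substitutions compose to the one of the product.
\<close>

definition shift :: "'a \<Rightarrow> 'a fps"
  where "shift g = linear_series ((g - 1) * \<eta> tvar) g"

lemma commute_shift_coeff:
  fixes x g :: 'a
  assumes "x * g = g * x"
  shows "x * ((g - 1) * \<eta> tvar) = (g - 1) * \<eta> tvar * x"
proof (rule commute_mult)
  show "x * (g - 1) = (g - 1) * x" by (simp add: assms left_diff_distrib right_diff_distrib)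
  show "x * \<eta> tvar = \<eta> tvar * x" by (rule eta_central)
qed

lemma nilpotent_shift_coeff:
  "nilpotent (g - 1) \<Longrightarrow> nilpotent ((g - 1) * \<eta> tvar)"
  by (rule nilpotent_mult) (simp_all only: eta_central)

lemma fps_subst_shift_bounded:
  assumes "nilpotent (g - 1)"
  obtains N where "\<And>b m M. m + N \<le> M \<Longrightarrow>
    fps_subst b (shift g) $ m = (\<Sum>n<M. b $ n * (shift g ^ n) $ m)"
proof -
  obtain N where N: "((g - 1) * \<eta> tvar) ^ N = 0"
    using nilpotent_shift_coeff[OF assms] unfolding nilpotent_def by blast
  have "g * ((g - 1) * \<eta> tvar) = (g - 1) * \<eta> tvar * g"
    by (rule commute_shift_coeff) simp
  then show thesis using N that[of N] unfolding shift_def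
    by (metis fps_subst_linear_nth)
qed

lemma fps_subst_shift_add:
  assumes "nilpotent (g - 1)"
  shows "fps_subst (b + c) (shift g) = fps_subst b (shift g) + fps_subst c (shift g)"
proof -
  obtain N where N: "\<And>b m M. m + N \<le> M \<Longrightarrow>
    fps_subst b (shift g) $ m = (\<Sum>n<M. b $ n * (shift g ^ n) $ m)"
    using fps_subst_shift_bounded[OF assms] by metis
  show ?thesis
    by (simp add: fps_eq_iff N[OF order.refl] sum.distrib distrib_right)
qed

lemma nilpotent_mult_minus_1:
  fixes g k :: 'a
  assumes "nilpotent (g - 1)" "nilpotent (k - 1)" and gk: "g * k = k * g"
  shows "nilpotent (g * k - 1)"
proof -
  have "g * k - 1 = (k - 1) + (g - 1) * k" by (simp add: left_diff_distrib)
  moreover have "nilpotent \<dots>"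
    using assms by (intro nilpotent_add_mult) (simp_all add: left_diff_distrib right_diff_distrib)
  ultimately show ?thesis by (simp only:)
qed

lemma fps_subst_shift_shift:
  assumes g: "nilpotent (g - 1)" and k: "nilpotent (k - 1)" and gk: "g * k = k * g"
  shows "fps_subst (fps_subst b (shift g)) (shift k) = fps_subst b (shift (g * k))"
proof (rule fps_ext)
  fix m
  obtain N where N: "\<And>b m M. m + N \<le> M \<Longrightarrow>
    fps_subst b (shift g) $ m = (\<Sum>n<M. b $ n * (shift g ^ n) $ m)"
    using fps_subst_shift_bounded[OF g] by metis
  obtain N' where N': "\<And>b m M. m + N' \<le> M \<Longrightarrow>
    fps_subst b (shift k) $ m = (\<Sum>n<M. b $ n * (shift k ^ n) $ m)"
    using fps_subst_shift_bounded[OF k] by metis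
  obtain N'' where N'': "\<And>b m M. m + N'' \<le> M \<Longrightarrow>
    fps_subst b (shift (g * k)) $ m = (\<Sum>n<M. b $ n * (shift (g * k) ^ n) $ m)"
    using fps_subst_shift_bounded[OF nilpotent_mult_minus_1[OF g k gk]] by metis
  let ?a = "(g - 1) * \<eta> tvar" and ?a' = "(k - 1) * \<eta> tvar"
  obtain R where R: "?a ^ R = 0"
    using nilpotent_shift_coeff[OF g] unfolding nilpotent_def by blast
  obtain R' where R': "?a' ^ R' = 0"
    using nilpotent_shift_coeff[OF k] unfolding nilpotent_def by blast
  have ga: "?a * g = g * ?a" and ka: "?a' * k = k * ?a'"
    by (rule commute_shift_coeff[symmetric], simp)+
  have "?a + g * ?a' = (g * k - 1) * \<eta> tvar"
    by (simp add: left_diff_distrib right_diff_distrib mult.assoc)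
  then have shift_gk: "shift (g * k) = linear_series (?a + g * ?a') (g * k)"
    by (simp add: shift_def)
  define I where "I = m + N' + R'"
  define J where "J = I + N + m + N''"
  have inner: "(\<Sum>i<I. (shift g ^ n) $ i * (shift k ^ i) $ m) = (shift (g * k) ^ n) $ m" for n
  proof -
    have "(\<Sum>i<I. (shift g ^ n) $ i * (shift k ^ i) $ m) =
        (\<Sum>i<I + Suc n. (shift g ^ n) $ i * (shift k ^ i) $ m)"
    proof (rule sum.mono_neutral_left)
      show "\<forall>i\<in>{..<I + Suc n} - {..<I}. (shift g ^ n) $ i * (shift k ^ i) $ m = 0"
        using linear_power_nth_eq_0[OF ka R'] by (auto simp: shift_def I_def)
    qed auto
    also have "\<dots> = (\<Sum>i\<le>n. (shift g ^ n) $ i * (shift k ^ i) $ m)"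
    proof (rule sum.mono_neutral_right)
      show "\<forall>i\<in>{..<I + Suc n} - {..n}. (shift g ^ n) $ i * (shift k ^ i) $ m = 0"
        using linear_power_nth_eq_0[OF ga R] by (auto simp: shift_def)
    qed auto
    also have "\<dots> = (shift (g * k) ^ n) $ m"
      unfolding shift_gk unfolding shift_def
    proof (rule linear_compose[OF ga R])
      show "k * ?a = ?a * k" using gk by (intro commute_shift_coeff) simp
      show "?a' * g = g * ?a'" using gk by (intro commute_shift_coeff[symmetric])
      show "?a' * ?a = ?a * ?a'"
        by (rule commute_shift_coeff) (use gk in \<open>intro commute_shift_coeff[symmetric]\<close>)
      show "k * g = g * k" using gk by simp
    qed
    finally show ?thesis .
  qed
  have "fps_subst (fps_subst b (shift g)) (shift k) $ m =
      (\<Sum>i<I. fps_subst b (shift g) $ i * (shift k ^ i) $ m)"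
    by (intro N') (simp add: I_def)
  also have "\<dots> = (\<Sum>i<I. \<Sum>n<J. b $ n * ((shift g ^ n) $ i * (shift k ^ i) $ m))"
    by (intro sum.cong refl) (simp add: N[of _ J] J_def sum_distrib_right mult.assoc)
  also have "\<dots> = (\<Sum>n<J. b $ n * (\<Sum>i<I. (shift g ^ n) $ i * (shift k ^ i) $ m))"
    unfolding sum_distrib_left by (rule sum.swap)
  also have "\<dots> = fps_subst b (shift (g * k)) $ m"
    unfolding inner by (rule N''[symmetric]) (simp add: J_def)
  finally show "fps_subst (fps_subst b (shift g)) (shift k) $ m = fps_subst b (shift (g * k)) $ m" .
qed

lemma commute_fps_subst_shift:
  assumes "nilpotent (g - 1)" "x * g = g * x" "\<And>n. x * b $ n = b $ n * x"
  shows "x * fps_subst b (shift g) $ m = fps_subst b (shift g) $ m * x"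
proof -
  obtain N where N: "\<And>b m M. m + N \<le> M \<Longrightarrow>
    fps_subst b (shift g) $ m = (\<Sum>n<M. b $ n * (shift g ^ n) $ m)"
    using fps_subst_shift_bounded[OF assms(1)] by metis
  have "x * (shift g ^ n) $ m = (shift g ^ n) $ m * x" for n
    unfolding shift_def using assms(2) by (intro commute_linear_power commute_shift_coeff)
  then show ?thesis
    unfolding N[OF order.refl] by (intro commute_sum commute_mult assms(3))
qed

text \<open>
  A sum of nilpotent elements that do not commute need not be nilpotent. But up to multiples of
  the nilpotent \<open>a = (g - 1) t\<close>, which commutes with all \<open>b\<^sub>n\<close> and with \<open>g\<close>, the coefficient of
  \<open>W\<^sub>1\<^sup>m\<close> in \<open>b((g - 1) t + g W\<^sub>1)\<close> is the single term \<open>b\<^sub>m g\<^sup>m\<close>.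
\<close>

lemma nilpotent_fps_subst_shift:
  assumes g: "nilpotent (g - 1)" and b: "nilpotent (b $ m)" and comm: "\<And>n. b $ n * g = g * b $ n"
  shows "nilpotent (fps_subst b (shift g) $ m)"
proof -
  obtain N where N: "\<And>b m M. m + N \<le> M \<Longrightarrow>
    fps_subst b (shift g) $ m = (\<Sum>n<M. b $ n * (shift g ^ n) $ m)"
    using fps_subst_shift_bounded[OF g] by metis
  define a where "a = (g - 1) * \<eta> tvar"
  have ag: "a * g = g * a" unfolding a_def by (rule commute_shift_coeff[symmetric]) simp
  have ab: "a * b $ n = b $ n * a" for n
    unfolding a_def using comm by (intro commute_shift_coeff[symmetric])
  define M where "M = Suc m + N"
  define y where "y n = b $ n * (sc (of_nat (n choose m)) * (a ^ (n - Suc m) * g ^ m))" for n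
  have term_eq: "b $ n * (shift g ^ n) $ m =
      (if n < m then 0 else if n = m then b $ m * g ^ m else a * y n)" for n
  proof (cases "m < n")
    case True
    then have n: "n - m = Suc (n - Suc m)" by simp
    have "b $ n * (shift g ^ n) $ m =
        b $ n * (sc (of_nat (n choose m)) * (a * (a ^ (n - Suc m) * g ^ m)))"
      unfolding shift_def a_def[symmetric] linear_power_nth[OF ag] n
      by (simp only: power_Suc mult.assoc)
    also have "sc (of_nat (n choose m)) * (a * (a ^ (n - Suc m) * g ^ m)) =
        a * (sc (of_nat (n choose m)) * (a ^ (n - Suc m) * g ^ m))"
      by (rule eta_left_commute[symmetric])
    also have "b $ n * \<dots> = a * y n"
      unfolding y_def by (simp only: ab mult.assoc[symmetric])
    finally show ?thesis using True by simp
  next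
    case False
    then show ?thesis unfolding shift_def a_def[symmetric] linear_power_nth[OF ag]
      by (auto simp: binomial_eq_0)
  qed
  have "fps_subst b (shift g) $ m =
      (\<Sum>n<M. if n < m then 0 else if n = m then b $ m * g ^ m else a * y n)"
    unfolding term_eq[symmetric] by (rule N) (simp add: M_def)
  also have "\<dots> = b $ m * g ^ m +
      (\<Sum>n\<in>{..<M} - {m}. if n < m then 0 else if n = m then b $ m * g ^ m else a * y n)"
    by (subst sum.remove[of _ m]) (auto simp: M_def)
  also have "(\<Sum>n\<in>{..<M} - {m}. if n < m then 0 else if n = m then b $ m * g ^ m else a * y n) =
      a * (\<Sum>n\<in>{..<M} - {m}. if n < m then 0 else y n)"
    unfolding sum_distrib_left by (intro sum.cong) auto
  finally have "fps_subst b (shift g) $ m =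
      b $ m * g ^ m + a * (\<Sum>n\<in>{..<M} - {m}. if n < m then 0 else y n)" .
  moreover have "nilpotent \<dots>"
  proof (rule nilpotent_add_mult)
    show "nilpotent (b $ m * g ^ m)"
      using b comm by (intro nilpotent_mult commute_power)
    show "nilpotent a" unfolding a_def by (rule nilpotent_shift_coeff[OF g])
    show "a * (b $ m * g ^ m) = b $ m * g ^ m * a"
      using ab ag by (intro commute_mult commute_power)
    have "a * y n = y n * a" for n
      unfolding y_def using ab ag by (intro commute_mult commute_power eta_central refl)
    then show "a * (\<Sum>n\<in>{..<M} - {m}. if n < m then 0 else y n) =
        (\<Sum>n\<in>{..<M} - {m}. if n < m then 0 else y n) * a"
      by (intro commute_sum) simp
  qed
  ultimately show ?thesis by simp
qed

end

context nc_alg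
begin

lemma QGIII_prod_trans_pair:
  "QGIII_prod \<eta> (trans_pair \<eta> e 0 b) (trans_pair \<eta> g 0 c) =
     trans_pair \<eta> (e * g) 0 (fps_subst b (shift g) + c)"
  unfolding QGIII_prod_def Let_def par_trans_pair
  by (simp add: trans_pair_def shift_def linear_series_def add.assoc)

lemma mutually_commute_trans_pair:
  "mutually_commute \<eta> (trans_pair \<eta> e 0 b) (trans_pair \<eta> g 0 c) \<longleftrightarrow>
     e * g = g * e \<and> (\<forall>n. e * c $ n = c $ n * e) \<and> (\<forall>n. b $ n * g = g * b $ n) \<and>
     (\<forall>m n. b $ m * c $ n = c $ n * b $ m)"
  by (auto simp: mutually_commute_def params_def)

lemma QGIII_E:
  assumes "u \<in> QGIII q \<eta>"
  obtains e b where "u = trans_pair \<eta> e 0 b" "admissible e b"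
  using assms unfolding QGIII_eq by blast

lemma admissibleD:
  assumes "admissible e b"
  shows "nilpotent (e - 1)" "nilpotent (b $ n)" "e * b $ n = b $ n * e"
  using assms by (auto simp: admissible_def)

lemma QGIII_prod_closed:
  assumes u: "u \<in> QGIII q \<eta>" and v: "v \<in> QGIII q \<eta>" and uv: "mutually_commute \<eta> u v"
  shows "QGIII_prod \<eta> u v \<in> QGIII q \<eta>"
proof -
  obtain e b where u_eq: "u = trans_pair \<eta> e 0 b" and eb: "admissible e b" using QGIII_E[OF u] .
  obtain g c where v_eq: "v = trans_pair \<eta> g 0 c" and gc: "admissible g c" using QGIII_E[OF v] .
  note eb = admissibleD[OF eb] and gc = admissibleD[OF gc]
  have comm: "e * g = g * e" "e * c $ n = c $ n * e" "b $ n * g = g * b $ n"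
    "b $ m * c $ n = c $ n * b $ m" for m n
    using uv unfolding u_eq v_eq mutually_commute_trans_pair by blast+
  have x: "x * fps_subst b (shift g) $ n = fps_subst b (shift g) $ n * x"
    if "x * g = g * x" "\<And>n. x * b $ n = b $ n * x" for x n
    by (rule commute_fps_subst_shift[OF gc(1) that])
  have "admissible (e * g) (fps_subst b (shift g) + c)"
    unfolding admissible_def
  proof (intro conjI allI)
    fix n
    show "nilpotent (e * g - 1)"
      by (rule nilpotent_mult_minus_1[OF eb(1) gc(1) comm(1)])
    show "nilpotent ((fps_subst b (shift g) + c) $ n)"
      unfolding fps_add_nth
    proof (rule nilpotent_add)
      show "nilpotent (fps_subst b (shift g) $ n)"
        by (rule nilpotent_fps_subst_shift[OF gc(1) eb(2) comm(3)])
      show "nilpotent (c $ n)" by (rule gc(2))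
      show "fps_subst b (shift g) $ n * c $ n = c $ n * fps_subst b (shift g) $ n"
        by (rule x[symmetric]) (simp_all only: gc(3) comm(4))
    qed
    have "e * (fps_subst b (shift g) + c) $ n = (fps_subst b (shift g) + c) $ n * e"
      unfolding fps_add_nth by (intro commute_add x) (simp_all only: comm eb(3))
    moreover have "g * (fps_subst b (shift g) + c) $ n = (fps_subst b (shift g) + c) $ n * g"
      unfolding fps_add_nth by (intro commute_add x) (simp_all only: comm gc(3))
    ultimately show "e * g * (fps_subst b (shift g) + c) $ n =
        (fps_subst b (shift g) + c) $ n * (e * g)"
      by (intro commute_mult[symmetric]) (simp_all only:)
  qed
  then show ?thesis unfolding u_eq v_eq QGIII_prod_trans_pair QGIII_eq by blast
qed

lemma mutually_commute_prod:
  assumes u: "u \<in> QGIII q \<eta>" and v: "v \<in> QGIII q \<eta>" and w: "w \<in> QGIII q \<eta>"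
    and uv: "mutually_commute \<eta> u v" and uw: "mutually_commute \<eta> u w"
    and vw: "mutually_commute \<eta> v w"
  shows "mutually_commute \<eta> u (QGIII_prod \<eta> v w)" "mutually_commute \<eta> (QGIII_prod \<eta> u v) w"
proof -
  obtain e b where u_eq: "u = trans_pair \<eta> e 0 b" and eb: "admissible e b" using QGIII_E[OF u] .
  obtain g c where v_eq: "v = trans_pair \<eta> g 0 c" and gc: "admissible g c" using QGIII_E[OF v] .
  obtain k d where w_eq: "w = trans_pair \<eta> k 0 d" and kd: "admissible k d" using QGIII_E[OF w] .
  note eb = admissibleD[OF eb] and gc = admissibleD[OF gc] and kd = admissibleD[OF kd]
  have uv: "e * g = g * e" "e * c $ n = c $ n * e" "b $ n * g = g * b $ n"
    "b $ m * c $ n = c $ n * b $ m" for m n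
    using uv unfolding u_eq v_eq mutually_commute_trans_pair by blast+
  have uw: "e * k = k * e" "e * d $ n = d $ n * e" "b $ n * k = k * b $ n"
    "b $ m * d $ n = d $ n * b $ m" for m n
    using uw unfolding u_eq w_eq mutually_commute_trans_pair by blast+
  have vw: "g * k = k * g" "g * d $ n = d $ n * g" "c $ n * k = k * c $ n"
    "c $ m * d $ n = d $ n * c $ m" for m n
    using vw unfolding v_eq w_eq mutually_commute_trans_pair by blast+
  show "mutually_commute \<eta> u (QGIII_prod \<eta> v w)"
    unfolding u_eq v_eq w_eq QGIII_prod_trans_pair mutually_commute_trans_pair fps_add_nth
    by (intro conjI allI commute_mult commute_add commute_fps_subst_shift kd(1) uv uw)
  show "mutually_commute \<eta> (QGIII_prod \<eta> u v) w"
    unfolding u_eq v_eq w_eq QGIII_prod_trans_pair mutually_commute_trans_pair fps_add_nth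
    by (intro conjI allI commute_mult[symmetric] commute_add[symmetric]
        commute_fps_subst_shift gc(1) uw[symmetric] vw[symmetric])
qed

lemma QGIII_prod_assoc:
  assumes u: "u \<in> QGIII q \<eta>" and v: "v \<in> QGIII q \<eta>" and w: "w \<in> QGIII q \<eta>"
    and vw: "mutually_commute \<eta> v w"
  shows "QGIII_prod \<eta> u (QGIII_prod \<eta> v w) = QGIII_prod \<eta> (QGIII_prod \<eta> u v) w"
proof -
  obtain e b where u_eq: "u = trans_pair \<eta> e 0 b" using QGIII_E[OF u] .
  obtain g c where v_eq: "v = trans_pair \<eta> g 0 c" and gc: "admissible g c" using QGIII_E[OF v] .
  obtain k d where w_eq: "w = trans_pair \<eta> k 0 d" and kd: "admissible k d" using QGIII_E[OF w] .
  have "g * k = k * g"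
    using vw unfolding v_eq w_eq mutually_commute_trans_pair by blast
  then show ?thesis
    unfolding u_eq v_eq w_eq QGIII_prod_trans_pair
    using admissibleD(1)[OF gc] admissibleD(1)[OF kd]
    by (simp only: fps_subst_shift_add fps_subst_shift_shift mult.assoc add.assoc)
qed

lemma QGIII_unit_eq: "QGIII_unit \<eta> = trans_pair \<eta> 1 0 0"
  by (simp add: QGIII_unit_def trans_pair_def)

lemma QGIII_unit_in: "QGIII_unit \<eta> \<in> QGIII q \<eta>"
  unfolding QGIII_unit_eq QGIII_eq admissible_def
  by (rule CollectI, rule exI[of _ 1], rule exI[of _ 0]) simp

lemma QGIII_unit_prod:
  assumes "v \<in> QGIII q \<eta>"
  shows "mutually_commute \<eta> (QGIII_unit \<eta>) v" "QGIII_prod \<eta> (QGIII_unit \<eta>) v = v"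
proof -
  obtain g c where v_eq: "v = trans_pair \<eta> g 0 c" using QGIII_E[OF assms] .
  show "mutually_commute \<eta> (QGIII_unit \<eta>) v"
    unfolding v_eq QGIII_unit_eq mutually_commute_trans_pair by simp
  have "fps_subst 0 s = (0 :: 'a fps)" for s
    by (rule fps_ext) (simp add: fps_subst_def)
  then show "QGIII_prod \<eta> (QGIII_unit \<eta>) v = v"
    unfolding v_eq QGIII_unit_eq QGIII_prod_trans_pair by simp
qed

section \<open>The operation on deformations\<close>

text \<open>
  A deformation is determined by its pair, so that all identities of the operation are identities
  of products of pairs.
\<close>

lemma QGIII_act_eqI:
  assumes "\<psi> \<in> NCF q lq \<eta>" "to_QGIII q lq \<eta> \<psi> = QGIII_prod \<eta> u (to_QGIII q lq \<eta> \<phi>)"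
  shows "QGIII_act q lq \<eta> u \<phi> = \<psi>"
  unfolding QGIII_act_def using inj_to_QGIII assms by (intro inv_into_f_eq) auto

context
  assumes bij: "bij_betw (to_QG3 q lq \<eta>) (NCF q lq \<eta>) (QG3 q \<eta>)"
begin

lemma QGIII_act:
  assumes "u \<in> QGIII q \<eta>" "\<phi> \<in> NCF q lq \<eta>" "mutually_commute \<eta> u (to_QGIII q lq \<eta> \<phi>)"
  shows "QGIII_act q lq \<eta> u \<phi> \<in> NCF q lq \<eta>"
    and "to_QGIII q lq \<eta> (QGIII_act q lq \<eta> u \<phi>) = QGIII_prod \<eta> u (to_QGIII q lq \<eta> \<phi>)"
proof -
  have "QGIII_prod \<eta> u (to_QGIII q lq \<eta> \<phi>) \<in> to_QGIII q lq \<eta> ` NCF q lq \<eta>"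
    using QGIII_prod_closed[OF assms(1) to_QGIII_in assms(3)] assms(2) bij_to_QGIII[OF bij]
    by (simp add: bij_betw_def)
  then show "QGIII_act q lq \<eta> u \<phi> \<in> NCF q lq \<eta>"
    "to_QGIII q lq \<eta> (QGIII_act q lq \<eta> u \<phi>) = QGIII_prod \<eta> u (to_QGIII q lq \<eta> \<phi>)"
    unfolding QGIII_act_def by (simp_all add: inv_into_into f_inv_into_f)
qed

lemma QGIII_act_unit:
  assumes "\<phi> \<in> NCF q lq \<eta>"
  shows "QGIII_act q lq \<eta> (QGIII_unit \<eta>) \<phi> = \<phi>"
  using assms by (intro QGIII_act_eqI) (simp_all add: QGIII_unit_prod to_QGIII_in)

lemma QGIII_act_assoc:
  assumes u: "u \<in> QGIII q \<eta>" and v: "v \<in> QGIII q \<eta>" and \<phi>: "\<phi> \<in> NCF q lq \<eta>"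
    and uv: "mutually_commute \<eta> u v" and u\<phi>: "mutually_commute \<eta> u (to_QGIII q lq \<eta> \<phi>)"
    and v\<phi>: "mutually_commute \<eta> v (to_QGIII q lq \<eta> \<phi>)"
  shows "mutually_commute \<eta> u (to_QGIII q lq \<eta> (QGIII_act q lq \<eta> v \<phi>))"
    and "mutually_commute \<eta> (QGIII_prod \<eta> u v) (to_QGIII q lq \<eta> \<phi>)"
    and "QGIII_act q lq \<eta> u (QGIII_act q lq \<eta> v \<phi>) = QGIII_act q lq \<eta> (QGIII_prod \<eta> u v) \<phi>"
proof -
  note w = to_QGIII_in[OF \<phi>]
  note act_v = QGIII_act[OF v \<phi> v\<phi>]
  show 1: "mutually_commute \<eta> u (to_QGIII q lq \<eta> (QGIII_act q lq \<eta> v \<phi>))"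
    unfolding act_v by (rule mutually_commute_prod(1)[OF u v w uv u\<phi> v\<phi>])
  show 2: "mutually_commute \<eta> (QGIII_prod \<eta> u v) (to_QGIII q lq \<eta> \<phi>)"
    by (rule mutually_commute_prod(2)[OF u v w uv u\<phi> v\<phi>])
  note act_uv = QGIII_act[OF QGIII_prod_closed[OF u v uv] \<phi> 2]
  have "to_QGIII q lq \<eta> (QGIII_act q lq \<eta> (QGIII_prod \<eta> u v) \<phi>) =
      QGIII_prod \<eta> u (to_QGIII q lq \<eta> (QGIII_act q lq \<eta> v \<phi>))"
    unfolding act_uv act_v by (rule QGIII_prod_assoc[OF u v w v\<phi>, symmetric])
  then show "QGIII_act q lq \<eta> u (QGIII_act q lq \<eta> v \<phi>) = QGIII_act q lq \<eta> (QGIII_prod \<eta> u v) \<phi>"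
    by (intro QGIII_act_eqI act_uv(1))
qed

end

end

section \<open>Functoriality\<close>

text \<open>
  Ring homomorphisms that need not preserve \<open>1\<close>; the notion passes from \<open>h\<close> to the maps that it
  induces on each of the layers of power series.
\<close>

definition rng_hom :: "('a::ring \<Rightarrow> 'b::ring) \<Rightarrow> bool" where
  "rng_hom h \<longleftrightarrow> (\<forall>x y. h (x + y) = h x + h y) \<and> (\<forall>x y. h (x * y) = h x * h y)"

lemma rng_homD:
  assumes "rng_hom h"
  shows "h (x + y) = h x + h y" "h (x * y) = h x * h y" "h 0 = 0" "h (- x) = - h x"
    "h (x - y) = h x - h y" "h (\<Sum>i\<in>I. F i) = (\<Sum>i\<in>I. h (F i))"
proof -
  show add: "h (x + y) = h x + h y" for x y using assms by (simp add: rng_hom_def)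
  show "h (x * y) = h x * h y" using assms by (simp add: rng_hom_def)
  show 0: "h 0 = 0" using add[of 0 0] by simp
  show minus: "h (- x) = - h x" for x
    using add[of "- x" x] 0 by (simp add: eq_neg_iff_add_eq_0)
  show "h (x - y) = h x - h y" using add[of x "- y"] minus by simp
  show "h (\<Sum>i\<in>I. F i) = (\<Sum>i\<in>I. h (F i))"
    by (induction I rule: infinite_finite_induct) (simp_all add: 0 add)
qed

lemma map_fps_nth [simp]: "map_fps h F $ n = h (F $ n)"
  by (simp add: map_fps_def)

lemma map_fps2_nth [simp]: "map_fps2 h F $ m $ n = h (F $ m $ n)"
  by (simp add: map_fps2_def)

lemma rng_hom_map_fps: "rng_hom h \<Longrightarrow> rng_hom (map_fps h)"
  unfolding rng_hom_def[of "map_fps h"]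
  by (auto simp: fps_eq_iff fps_mult_nth rng_homD)

lemma rng_hom_map_fps2: "rng_hom h \<Longrightarrow> rng_hom (map_fps2 h)"
  unfolding map_fps2_def by (intro rng_hom_map_fps)

lemma rng_hom_map_tps: "rng_hom h \<Longrightarrow> rng_hom (map_tps h)"
  unfolding rng_hom_def[of "map_tps h"]
  by (auto intro!: tps_eqI simp: tps_nth_mult rng_homD)

locale nc_alg_hom = src: nc_alg q lq \<eta> + tgt: nc_alg q lq \<eta>'
  for q lq :: complex and \<eta> :: "ratfun \<Rightarrow> 'a::{ring, monoid_mult}"
    and \<eta>' :: "ratfun \<Rightarrow> 'b::{ring, monoid_mult}" +
  fixes h :: "'a \<Rightarrow> 'b"
  assumes nc_algebra_hom: "nc_algebra_hom \<eta> \<eta>' h"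
begin

lemma rng_hom: "rng_hom h"
  using nc_algebra_hom by (simp add: nc_algebra_hom_def rng_hom_def)

lemmas h_simps [simp] = rng_homD[OF rng_hom]

lemma h_eta [simp]: "h (\<eta> x) = \<eta>' x"
  using nc_algebra_hom by (simp add: nc_algebra_hom_def)

lemma h_1 [simp]: "h 1 = 1"
  using h_eta[of 1] by simp

lemma h_power [simp]: "h (x ^ n) = h x ^ n"
  by (induction n) simp_all

lemma h_nilpotent: "nilpotent x \<Longrightarrow> nilpotent (h x)"
  unfolding nilpotent_def by (metis h_power h_simps(3))

lemma map_fps2_scalar: "map_fps2 h (scalar2 \<eta> c * F) = scalar2 \<eta>' c * map_fps2 h F"
  by (rule fps2_eqI) simp

lemma map_fps2_taylor: "map_fps2 h (taylor \<eta> a) = taylor \<eta>' a"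
  by (rule fps2_eqI) (simp only: map_fps2_nth src.taylor_nth tgt.taylor_nth h_eta)

lemma map_fps2_deriv:
  "map_fps2 h (deriv_W1 F) = deriv_W1 (map_fps2 h F)"
  "map_fps2 h (deriv_W2 F) = deriv_W2 (map_fps2 h F)"
  by (rule fps2_eqI; simp add: src.deriv_W1_nth tgt.deriv_W1_nth src.deriv_W2_nth tgt.deriv_W2_nth
      del: of_nat_Suc)+

text \<open>
  Applying \<open>h\<close> to all coefficients in \<open>A\<close> commutes with every operator in the definition of a
  deformation, because their scalars and the canonical morphism come from \<open>L\<close>, and \<open>h\<close> is a
  morphism over \<open>L\<close>.
\<close>

lemma NCF_map_NCF:
  assumes \<phi>: "\<phi> \<in> NCF q lq \<eta>"
  shows "NCF_map q lq h \<phi> \<in> NCF q lq \<eta>'"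
proof -
  let ?G = "galois_hull q lq"
  let ?H = "map_tps (map_fps2 h) :: 'a fps2 tps \<Rightarrow> 'b fps2 tps"
  define \<psi> where "\<psi> = NCF_map q lq h \<phi>"
  have \<psi>: "\<psi> F = ?H (\<phi> F)" if "F \<in> ?G" for F
    using that by (simp add: \<psi>_def NCF_map_def)
  note H = rng_homD[OF rng_hom_map_tps[OF rng_hom_map_fps2[OF rng_hom]]]
  have 1: "?H 1 = 1"
    by (rule tps_eqI, rule fps2_eqI) simp
  have Sigma: "?H (hat_Sigma (scalar2 \<eta>) q Y) = hat_Sigma (scalar2 \<eta>') q (?H Y)" for Y
    by (rule tps_eqI) (simp only: tps_nth_simps map_fps2_scalar)
  have Theta: "?H (hat_Theta (scalar2 \<eta>) q l Y) = hat_Theta (scalar2 \<eta>') q l (?H Y)" for l Y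
    by (rule tps_eqI) (simp only: tps_nth_simps map_fps2_scalar)
  have deriv: "?H (map_tps deriv_W1 Y) = map_tps deriv_W1 (?H Y)"
    "?H (map_tps deriv_W2 Y) = map_tps deriv_W2 (?H Y)" for Y
    by (rule tps_eqI; simp only: tps_nth_simps map_fps2_deriv)+
  have iota: "?H (iota \<eta> F) = iota \<eta>' F" for F
    by (rule tps_eqI) (simp only: iota_def tps_nth_simps map_fps2_taylor)
  have "nilpotent (tps_nth (\<psi> F - iota \<eta>' F) i n $ m $ l)" if "F \<in> ?G" for F i n m l
  proof -
    have "\<psi> F - iota \<eta>' F = ?H (\<phi> F - iota \<eta> F)" using that by (simp only: \<psi> H iota)
    then show ?thesis using h_nilpotent[OF src.phi_nilpotent[OF \<phi> that]] by simp
  qed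
  moreover have "\<psi> (tps_const a) = iota \<eta>' (tps_const a)" for a
    using \<phi> by (simp add: \<psi> galois_hull.const iota[symmetric] NCF_def)
  moreover have "\<psi> \<in> extensional ?G" by (simp add: \<psi>_def NCF_map_def)
  moreover have "\<psi> 1 = 1"
    using \<psi>[OF src.hull_1] 1 by (simp add: src.phi_1[OF \<phi>])
  moreover have "\<psi> (F + G) = \<psi> F + \<psi> G" "\<psi> (F * G) = \<psi> F * \<psi> G"
    if "F \<in> ?G" "G \<in> ?G" for F G
    using that by (simp_all only: \<psi> galois_hull.add galois_hull.mult
        src.phi_add[OF \<phi>] src.phi_mult[OF \<phi>] H)
  moreover have "\<psi> (hat_Sigma cst q F) = hat_Sigma (scalar2 \<eta>') q (\<psi> F)"
    "\<psi> (hat_Theta cst q l F) = hat_Theta (scalar2 \<eta>') q l (\<psi> F)"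
    "\<psi> (map_tps deriv_t F) = map_tps deriv_W1 (\<psi> F)"
    "\<psi> (map_tps deriv_y F) = map_tps deriv_W2 (\<psi> F)" if "F \<in> ?G" for F l
    using that by (simp_all only: \<psi> galois_hull.hat_Sigma galois_hull.hat_Theta galois_hull.deriv_t
        galois_hull.deriv_y src.phi_Sigma[OF \<phi>] src.phi_Theta[OF \<phi>] src.phi_deriv_t[OF \<phi>]
        src.phi_deriv_y[OF \<phi>] Sigma Theta deriv)
  ultimately show ?thesis unfolding \<psi>_def[symmetric] NCF_def by blast
qed

lemma QGIII_map_trans_pair:
  "QGIII_map h (trans_pair \<eta> e f b) = trans_pair \<eta>' (h e) (h f) (map_fps h b)"
  unfolding QGIII_map_def src.trans_pair_eq tgt.trans_pair_eq map_prod_simp prod.inject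
  by (intro conjI fps2_eqI) (auto simp: src.lin_W1_nth tgt.lin_W1_nth const2_nth W2_nth)

lemma admissible_map: "src.admissible e b \<Longrightarrow> tgt.admissible (h e) (map_fps h b)"
  unfolding src.admissible_def tgt.admissible_def
  by (metis h_1 h_nilpotent h_simps(2,5) map_fps_nth)

lemma QGIII_map_QGIII: "u \<in> QGIII q \<eta> \<Longrightarrow> QGIII_map h u \<in> QGIII q \<eta>'"
  unfolding src.QGIII_eq tgt.QGIII_eq
  using QGIII_map_trans_pair[of _ 0] admissible_map by (auto simp: h_simps) blast

lemma to_QGIII_NCF_map:
  assumes \<phi>: "\<phi> \<in> NCF q lq \<eta>"
  shows "to_QGIII q lq \<eta>' (NCF_map q lq h \<phi>) = QGIII_map h (to_QGIII q lq \<eta> \<phi>)"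
proof -
  define \<psi> where "\<psi> = NCF_map q lq h \<phi>"
  have \<psi>: "\<psi> \<in> NCF q lq \<eta>'" unfolding \<psi>_def by (rule NCF_map_NCF[OF \<phi>])
  have iota0: "\<psi> (iota0 q lq a) = map_tps (map_fps2 h) (\<phi> (iota0 q lq a))" for a
    by (simp add: \<psi>_def NCF_map_def galois_hull.iota0)
  have "tgt.phi_e \<psi> = h (src.phi_e \<phi>)"
    by (simp add: src.phi_e_def[OF \<phi>] tgt.phi_e_def[OF \<psi>] src.phi_u_def[OF \<phi>]
        tgt.phi_u_def[OF \<psi>] iota0)
  moreover have "tgt.phi_b \<psi> = map_fps h (src.phi_b \<phi>)"
    by (rule fps_ext) (simp add: src.phi_b_def[OF \<phi>] tgt.phi_b_def[OF \<psi>] iota0)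
  ultimately show ?thesis
    unfolding \<psi>_def[symmetric] src.to_QGIII_eq[OF \<phi>] tgt.to_QGIII_eq[OF \<psi>] QGIII_map_trans_pair
    by simp
qed

lemma mutually_commute_map:
  assumes "u \<in> QGIII q \<eta>" "v \<in> QGIII q \<eta>" "mutually_commute \<eta> u v"
  shows "mutually_commute \<eta>' (QGIII_map h u) (QGIII_map h v)"
proof -
  obtain e b where u: "u = trans_pair \<eta> e 0 b" using src.QGIII_E[OF assms(1)] .
  obtain g c where v: "v = trans_pair \<eta> g 0 c" using src.QGIII_E[OF assms(2)] .
  show ?thesis
    using assms(3) unfolding u v QGIII_map_trans_pair h_simps(3) src.mutually_commute_trans_pair
      tgt.mutually_commute_trans_pair map_fps_nth h_simps(2)[symmetric] by simp
qed

lemma map_fps_shift_power: "map_fps h (src.shift g ^ n) = tgt.shift (h g) ^ n"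
proof (induction n)
  case 0
  then show ?case by (simp add: fps_eq_iff)
next
  case (Suc n)
  have "map_fps h (src.shift g) = tgt.shift (h g)"
    by (simp add: fps_eq_iff src.shift_def tgt.shift_def src.linear_series_def
        tgt.linear_series_def)
  with Suc show ?case by (simp add: rng_homD[OF rng_hom_map_fps[OF rng_hom]])
qed

lemma QGIII_map_prod:
  assumes "u \<in> QGIII q \<eta>" "v \<in> QGIII q \<eta>"
  shows "QGIII_map h (QGIII_prod \<eta> u v) = QGIII_prod \<eta>' (QGIII_map h u) (QGIII_map h v)"
proof -
  obtain e b where u: "u = trans_pair \<eta> e 0 b" using src.QGIII_E[OF assms(1)] .
  obtain g c where v: "v = trans_pair \<eta> g 0 c" and gc: "src.admissible g c"
    using src.QGIII_E[OF assms(2)] .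
  note g = src.admissibleD(1)[OF gc] and hg = tgt.admissibleD(1)[OF admissible_map[OF gc]]
  obtain N where N: "\<And>b m M. m + N \<le> M \<Longrightarrow>
    fps_subst b (src.shift g) $ m = (\<Sum>n<M. b $ n * (src.shift g ^ n) $ m)"
    using src.fps_subst_shift_bounded[OF g] by metis
  obtain N' where N': "\<And>b m M. m + N' \<le> M \<Longrightarrow>
    fps_subst b (tgt.shift (h g)) $ m = (\<Sum>n<M. b $ n * (tgt.shift (h g) ^ n) $ m)"
    using tgt.fps_subst_shift_bounded[OF hg] by metis
  have "map_fps h (fps_subst b (src.shift g)) = fps_subst (map_fps h b) (tgt.shift (h g))"
  proof (rule fps_ext)
    fix m
    show "map_fps h (fps_subst b (src.shift g)) $ m = fps_subst (map_fps h b) (tgt.shift (h g)) $ m"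
      using N[of m "m + N + N'" b] N'[of m "m + N + N'" "map_fps h b"]
      by (simp flip: map_fps_shift_power)
  qed
  then show ?thesis
    unfolding u v src.QGIII_prod_trans_pair QGIII_map_trans_pair h_simps(3)
      tgt.QGIII_prod_trans_pair by (simp add: rng_homD[OF rng_hom_map_fps[OF rng_hom]])
qed

lemma QGIII_act_map:
  assumes bij: "bij_betw (to_QG3 q lq \<eta>) (NCF q lq \<eta>) (QG3 q \<eta>)"
    and u: "u \<in> QGIII q \<eta>" and \<phi>: "\<phi> \<in> NCF q lq \<eta>"
    and comm: "mutually_commute \<eta> u (to_QGIII q lq \<eta> \<phi>)"
  shows "QGIII_act q lq \<eta>' (QGIII_map h u) (NCF_map q lq h \<phi>) =
    NCF_map q lq h (QGIII_act q lq \<eta> u \<phi>)"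
proof (rule tgt.QGIII_act_eqI)
  note act = src.QGIII_act[OF bij u \<phi> comm]
  show "NCF_map q lq h (QGIII_act q lq \<eta> u \<phi>) \<in> NCF q lq \<eta>'"
    by (rule NCF_map_NCF[OF act(1)])
  show "to_QGIII q lq \<eta>' (NCF_map q lq h (QGIII_act q lq \<eta> u \<phi>)) =
      QGIII_prod \<eta>' (QGIII_map h u) (to_QGIII q lq \<eta>' (NCF_map q lq h \<phi>))"
    unfolding to_QGIII_NCF_map[OF act(1)] to_QGIII_NCF_map[OF \<phi>] act(2)
    by (rule QGIII_map_prod[OF u src.to_QGIII_in[OF \<phi>]])
qed

end

section \<open>The inclusion and the operation\<close>

theorem theorem6p10:
  fixes q lq :: complex
    and \<eta> :: "ratfun \<Rightarrow> 'a::{ring, monoid_mult}"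
    and \<eta>' :: "ratfun \<Rightarrow> 'b::{ring, monoid_mult}"
    and h :: "'a \<Rightarrow> 'b"
  assumes "q \<noteq> 0" and "\<And>n. n > 0 \<Longrightarrow> q ^ n \<noteq> 1" and "exp lq = q"
    and "nc_algebra \<eta>" and "nc_algebra \<eta>'" and "nc_algebra_hom \<eta> \<eta>' h"
  shows
    "(\<forall>\<phi> \<in> NCF q lq \<eta>. has_params q lq \<eta> \<phi> (the_params q lq \<eta> \<phi>)) \<and>
     to_QGIII q lq \<eta> ` NCF q lq \<eta> \<subseteq> QGIII q \<eta> \<and>
     inj_on (to_QGIII q lq \<eta>) (NCF q lq \<eta>) \<and>
     NCF_map q lq h ` NCF q lq \<eta> \<subseteq> NCF q lq \<eta>' \<and>
     QGIII_map h ` QGIII q \<eta> \<subseteq> QGIII q \<eta>' \<and>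
     (\<forall>\<phi> \<in> NCF q lq \<eta>.
        to_QGIII q lq \<eta>' (NCF_map q lq h \<phi>) = QGIII_map h (to_QGIII q lq \<eta> \<phi>)) \<and>
     (bij_betw (to_QG3 q lq \<eta>) (NCF q lq \<eta>) (QG3 q \<eta>) \<longrightarrow>
       bij_betw (to_QGIII q lq \<eta>) (NCF q lq \<eta>) (QGIII q \<eta>) \<and>
       (\<forall>u \<in> QGIII q \<eta>. \<forall>v \<in> QGIII q \<eta>.
          mutually_commute \<eta> u v \<longrightarrow> QGIII_prod \<eta> u v \<in> QGIII q \<eta>) \<and>
       (\<forall>u \<in> QGIII q \<eta>. \<forall>\<phi> \<in> NCF q lq \<eta>. mutually_commute \<eta> u (to_QGIII q lq \<eta> \<phi>) \<longrightarrow>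
          QGIII_act q lq \<eta> u \<phi> \<in> NCF q lq \<eta> \<and>
          to_QGIII q lq \<eta> (QGIII_act q lq \<eta> u \<phi>) = QGIII_prod \<eta> u (to_QGIII q lq \<eta> \<phi>)) \<and>
       QGIII_unit \<eta> \<in> QGIII q \<eta> \<and>
       (\<forall>\<phi> \<in> NCF q lq \<eta>. mutually_commute \<eta> (QGIII_unit \<eta>) (to_QGIII q lq \<eta> \<phi>) \<and>
          QGIII_act q lq \<eta> (QGIII_unit \<eta>) \<phi> = \<phi>) \<and>
       (\<forall>u \<in> QGIII q \<eta>. \<forall>v \<in> QGIII q \<eta>. \<forall>\<phi> \<in> NCF q lq \<eta>.
          mutually_commute \<eta> u v \<longrightarrow>
          mutually_commute \<eta> u (to_QGIII q lq \<eta> \<phi>) \<longrightarrow>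
          mutually_commute \<eta> v (to_QGIII q lq \<eta> \<phi>) \<longrightarrow>
          mutually_commute \<eta> u (to_QGIII q lq \<eta> (QGIII_act q lq \<eta> v \<phi>)) \<and>
          mutually_commute \<eta> (QGIII_prod \<eta> u v) (to_QGIII q lq \<eta> \<phi>) \<and>
          QGIII_act q lq \<eta> u (QGIII_act q lq \<eta> v \<phi>) =
            QGIII_act q lq \<eta> (QGIII_prod \<eta> u v) \<phi>)) \<and>
     (bij_betw (to_QG3 q lq \<eta>) (NCF q lq \<eta>) (QG3 q \<eta>) \<and>
      bij_betw (to_QG3 q lq \<eta>') (NCF q lq \<eta>') (QG3 q \<eta>') \<longrightarrow>
       (\<forall>u \<in> QGIII q \<eta>. \<forall>\<phi> \<in> NCF q lq \<eta>. mutually_commute \<eta> u (to_QGIII q lq \<eta> \<phi>) \<longrightarrow>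
          mutually_commute \<eta>' (QGIII_map h u) (to_QGIII q lq \<eta>' (NCF_map q lq h \<phi>)) \<and>
          QGIII_act q lq \<eta>' (QGIII_map h u) (NCF_map q lq h \<phi>) =
            NCF_map q lq h (QGIII_act q lq \<eta> u \<phi>)))"
proof -
  interpret nc_alg_hom q lq \<eta> \<eta>' h
    using assms by unfold_locales
  have "\<forall>\<phi> \<in> NCF q lq \<eta>. has_params q lq \<eta> \<phi> (the_params q lq \<eta> \<phi>)"
    using src.has_params src.the_params_eq by metis
  moreover have "to_QGIII q lq \<eta> ` NCF q lq \<eta> \<subseteq> QGIII q \<eta>"
    "NCF_map q lq h ` NCF q lq \<eta> \<subseteq> NCF q lq \<eta>'"
    "QGIII_map h ` QGIII q \<eta> \<subseteq> QGIII q \<eta>'"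
    by (auto intro: src.to_QGIII_in NCF_map_NCF QGIII_map_QGIII)
  moreover have "mutually_commute \<eta>' (QGIII_map h u) (to_QGIII q lq \<eta>' (NCF_map q lq h \<phi>))"
    if "u \<in> QGIII q \<eta>" "\<phi> \<in> NCF q lq \<eta>" "mutually_commute \<eta> u (to_QGIII q lq \<eta> \<phi>)" for u \<phi>
    using mutually_commute_map[OF that(1) src.to_QGIII_in[OF that(2)] that(3)]
    by (simp add: to_QGIII_NCF_map that)
  ultimately show ?thesis
    using src.inj_to_QGIII to_QGIII_NCF_map src.QGIII_unit_in
    by (intro conjI ballI impI)
      (blast intro: src.bij_to_QGIII src.QGIII_prod_closed src.QGIII_act src.QGIII_act_unit
        src.QGIII_unit_prod src.to_QGIII_in src.QGIII_act_assoc QGIII_act_map)+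
qed

end
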